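(* Let $f\colon(\mathbb{R}^2,0)\to(\mathbb{R}^3,0)$ be a frontal with a $5/2$-cuspidal edge at $0$, with principal curvatures $\kappa_1,\kappa_2$ nowhere zero. Suppose that $\kappa_t\neq0$ at $0$. Then the Gaussian curvatures $K^{C_1}$ and $K^{C_2}$ of the focal surfaces $C_1$ and $C_2$ are given at $0$ by $$K^{C_j}=-\frac{\kappa_t^2\kappa_j^4}{\bigl(\kappa_t^2+(\kappa_\nu-\kappa_j)^2\bigr)^2}\qquad(j=1,2).$$ In particular, these are strictly negative at $0$.
   Context: All maps are $C^\infty$. A map germ $f\colon(\mathbb{R}^2,0)\to(\mathbb{R}^3,0)$ is a frontal if there is a smooth $\nu\colon(\mathbb{R}^2,0)\to\mathbb{S}^2$ (a unit normal vector field) with $\langle df_q(X),\nu(q)\rangle=0$ for all $q$ and $X\in T_q\mathbb{R}^2$. $S(f)=\{q: \operatorname{rank}df_q<2\}$. A null vector field along $S(f)$ is a nowhere vanishing vector field $\eta$ with $df(\eta)=0$ on $S(f)$. $f$ has a $5/2$-cuspidal edge at $0$ if its germ is $\mathcal{A}$-equivalent (equal up to diffeomorphism germs of source and target) to $(u,v)\mapsto(u,v^2,v^5)$ at the origin. Adapted coordinates: around a $5/2$-cuspidal edge there are coordinates $(u,v)$ with $S(f)=\{v=0\}$, $\partial_v$ a null vector field, and $\{f_u,f_{vv},\nu\}$ orthonormal along the $u$-axis; fix such coordinates. Then $f_v=vh$, $\nu_v=v\nu_1$ with $h,\nu_1$ smooth (a $5/2$-cuspidal edge is a so-called pure-frontal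 singular point, which guarantees $\nu_v(u,0)=0$). Put $\tilde E=\langle f_u,f_u\rangle$, $\tilde F=\langle f_u,h\rangle$, $\tilde G=\langle h,h\rangle$, $\tilde L=-\langle f_u,\nu_u\rangle$, $\tilde M=-\langle h,\nu_u\rangle$, $\tilde N_1=-\langle h,\nu_1\rangle$. The Gaussian and mean curvatures of $f$ extend smoothly as $K=\frac{\tilde L\tilde N_1-\tilde M^2}{\tilde E\tilde G-\tilde F^2}$, $H=\frac{\tilde E\tilde N_1-2\tilde F\tilde M+\tilde G\tilde L}{2(\tilde E\tilde G-\tilde F^2)}$, and the principal curvatures are $\kappa_1=H+\sqrt{H^2-K}$, $\kappa_2=H-\sqrt{H^2-K}$ (distinct and smooth near $0$ if $\kappa_t(0)\ne0$). Along the $u$-axis, the limiting normal curvature is $\kappa_\nu(u)=\tilde L(u,0)$ and the cuspidal torsion is $\kappa_t(u)=\tilde M(u,0)$. The focal surface associated to $\kappa_j$ is $C_j=f+\rho_j\nu$ with $\rho_j=1/\kappa_j$; under the hypotheses of the claim it is regular (an immersion) at $0$. *)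

theory Defs
  imports "HOL-Analysis.Analysis"
begin

section \<open>Smooth map germs\<close>

primrec Ck_on ::
  "nat \<Rightarrow> ('a::euclidean_space) set \<Rightarrow> ('a \<Rightarrow> 'b::euclidean_space) \<Rightarrow> bool" where
  "Ck_on 0 S f = continuous_on S f"
| "Ck_on (Suc k) S f =
    ((\<forall>x\<in>S. f differentiable (at x)) \<and>
     (\<forall>w. Ck_on k S (\<lambda>x. frechet_derivative f (at x) w)))"

text \<open>Only used on open sets, where it is the usual notion of a $C^\infty$ map.\<close>

definition smooth_on ::
  "('a::euclidean_space) set \<Rightarrow> ('a \<Rightarrow> 'b::euclidean_space) \<Rightarrow> bool" where
  "smooth_on S f \<longleftrightarrow> (\<forall>k. Ck_on k S f)"

text \<open>Germs at the origin are represented by total functions, of which only the values near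
  the origin matter.\<close>

definition smooth_germ :: "('a::euclidean_space \<Rightarrow> 'b::euclidean_space) \<Rightarrow> bool" where
  "smooth_germ f \<longleftrightarrow> (\<exists>U. open U \<and> 0 \<in> U \<and> smooth_on U f)"

definition diffeo_germ :: "('a::euclidean_space \<Rightarrow> 'a) \<Rightarrow> bool" where
  "diffeo_germ \<phi> \<longleftrightarrow> \<phi> 0 = 0 \<and>
    (\<exists>U V \<psi>. open U \<and> open V \<and> 0 \<in> U \<and> homeomorphism U V \<phi> \<psi> \<and>
             smooth_on U \<phi> \<and> smooth_on V \<psi>)"

definition A_equivalent ::
  "('a::euclidean_space \<Rightarrow> 'b::euclidean_space) \<Rightarrow> ('a \<Rightarrow> 'b) \<Rightarrow> bool" where
  "A_equivalent f g \<longleftrightarrow>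
    (\<exists>\<sigma> \<tau>. diffeo_germ \<sigma> \<and> diffeo_germ \<tau> \<and>
           (\<forall>\<^sub>F q in nhds 0. \<tau> (f q) = g (\<sigma> q)))"


section \<open>Frontals and \<open>5/2\<close>-cuspidal edges\<close>

text \<open>The coordinates of \<open>q :: real^2\<close> are \<open>u = q$1\<close> and \<open>v = q$2\<close>, so that
  \<open>pd 1\<close> and \<open>pd 2\<close> are the partial derivatives in \<open>u\<close> and \<open>v\<close>.\<close>

definition pd :: "2 \<Rightarrow> (real^2 \<Rightarrow> real^3) \<Rightarrow> real^2 \<Rightarrow> real^3" where
  "pd i f q = frechet_derivative f (at q) (axis i 1)"

text \<open>\<open>f\<close> is a frontal germ \<open>(\<real>\<^sup>2,0) \<rightarrow> (\<real>\<^sup>3,0)\<close> with unit normal vector field \<open>\<nu>\<close>.\<close>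

definition frontal_with_normal :: "(real^2 \<Rightarrow> real^3) \<Rightarrow> (real^2 \<Rightarrow> real^3) \<Rightarrow> bool" where
  "frontal_with_normal f \<nu> \<longleftrightarrow>
    f 0 = 0 \<and> smooth_germ f \<and> smooth_germ \<nu> \<and>
    (\<forall>\<^sub>F q in nhds 0. norm (\<nu> q) = 1 \<and>
       (\<forall>X. frechet_derivative f (at q) X \<bullet> \<nu> q = 0))"

definition singular_set :: "(real^2 \<Rightarrow> real^3) \<Rightarrow> (real^2) set" where
  "singular_set f = {q. rank (jacobian f (at q)) < 2}"

definition cuspidal_edge_5_2 :: "(real^2 \<Rightarrow> real^3) \<Rightarrow> bool" where
  "cuspidal_edge_5_2 f \<longleftrightarrow>
    A_equivalent f (\<lambda>q. vector [q$1, (q$2)^2, (q$2)^5])"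

text \<open>\<open>f\<close> and \<open>\<nu>\<close> are expressed in adapted coordinates: near the origin the singular set is
  the \<open>u\<close>-axis, \<open>\<partial>\<^sub>v\<close> is a null vector field along it, and \<open>f\<^sub>u\<close>, \<open>f\<^sub>v\<^sub>v\<close>, \<open>\<nu>\<close> are orthonormal
  there.\<close>

definition adapted :: "(real^2 \<Rightarrow> real^3) \<Rightarrow> (real^2 \<Rightarrow> real^3) \<Rightarrow> bool" where
  "adapted f \<nu> \<longleftrightarrow>
    (\<forall>\<^sub>F q in nhds 0. q \<in> singular_set f \<longleftrightarrow> q$2 = 0) \<and>
    (\<forall>\<^sub>F q in nhds 0. q \<in> singular_set f \<longrightarrow>
        frechet_derivative f (at q) (axis 2 1) = 0) \<and>
    (\<forall>\<^sub>F q in nhds 0. q$2 = 0 \<longrightarrow>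
        norm (pd 1 f q) = 1 \<and> norm (pd 2 (pd 2 f) q) = 1 \<and> norm (\<nu> q) = 1 \<and>
        pd 1 f q \<bullet> pd 2 (pd 2 f) q = 0 \<and> pd 1 f q \<bullet> \<nu> q = 0 \<and>
        pd 2 (pd 2 f) q \<bullet> \<nu> q = 0)"


section \<open>Invariants in adapted coordinates\<close>

text \<open>The smooth \<open>k\<close> with \<open>g = v k\<close> near the origin. By continuity at \<open>v = 0\<close> its germ is unique
  whenever it exists, and it exists for smooth \<open>g\<close> vanishing on the \<open>u\<close>-axis.\<close>

definition div_v :: "(real^2 \<Rightarrow> real^3) \<Rightarrow> real^2 \<Rightarrow> real^3" where
  "div_v g = (SOME k. smooth_germ k \<and> (\<forall>\<^sub>F q in nhds 0. g q = q$2 *\<^sub>R k q))"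

text \<open>\<open>div_v (pd 2 f)\<close> is $h$ in $f_v = v h$ and \<open>div_v (pd 2 \<nu>)\<close> is $\nu_1$ in
  $\nu_v = v \nu_1$.\<close>

definition tE :: "(real^2 \<Rightarrow> real^3) \<Rightarrow> real^2 \<Rightarrow> real" where
  "tE f q = pd 1 f q \<bullet> pd 1 f q"

definition tF :: "(real^2 \<Rightarrow> real^3) \<Rightarrow> real^2 \<Rightarrow> real" where
  "tF f q = pd 1 f q \<bullet> div_v (pd 2 f) q"

definition tG :: "(real^2 \<Rightarrow> real^3) \<Rightarrow> real^2 \<Rightarrow> real" where
  "tG f q = div_v (pd 2 f) q \<bullet> div_v (pd 2 f) q"

definition tL :: "(real^2 \<Rightarrow> real^3) \<Rightarrow> (real^2 \<Rightarrow> real^3) \<Rightarrow> real^2 \<Rightarrow> real" where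
  "tL f \<nu> q = - (pd 1 f q \<bullet> pd 1 \<nu> q)"

definition tM :: "(real^2 \<Rightarrow> real^3) \<Rightarrow> (real^2 \<Rightarrow> real^3) \<Rightarrow> real^2 \<Rightarrow> real" where
  "tM f \<nu> q = - (div_v (pd 2 f) q \<bullet> pd 1 \<nu> q)"

definition tN1 :: "(real^2 \<Rightarrow> real^3) \<Rightarrow> (real^2 \<Rightarrow> real^3) \<Rightarrow> real^2 \<Rightarrow> real" where
  "tN1 f \<nu> q = - (div_v (pd 2 f) q \<bullet> div_v (pd 2 \<nu>) q)"

text \<open>Gaussian, mean and principal curvatures of the frontal, extended across the singular set.\<close>

definition frontal_K :: "(real^2 \<Rightarrow> real^3) \<Rightarrow> (real^2 \<Rightarrow> real^3) \<Rightarrow> real^2 \<Rightarrow> real" where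
  "frontal_K f \<nu> q =
    (tL f \<nu> q * tN1 f \<nu> q - (tM f \<nu> q)\<^sup>2) / (tE f q * tG f q - (tF f q)\<^sup>2)"

definition frontal_H :: "(real^2 \<Rightarrow> real^3) \<Rightarrow> (real^2 \<Rightarrow> real^3) \<Rightarrow> real^2 \<Rightarrow> real" where
  "frontal_H f \<nu> q =
    (tE f q * tN1 f \<nu> q - 2 * tF f q * tM f \<nu> q + tG f q * tL f \<nu> q)
      / (2 * (tE f q * tG f q - (tF f q)\<^sup>2))"

text \<open>The index \<open>j\<close> is 1 or 2.\<close>

definition principal_curvature ::
  "nat \<Rightarrow> (real^2 \<Rightarrow> real^3) \<Rightarrow> (real^2 \<Rightarrow> real^3) \<Rightarrow> real^2 \<Rightarrow> real" where
  "principal_curvature j f \<nu> q =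
    (if j = 1
     then frontal_H f \<nu> q + sqrt ((frontal_H f \<nu> q)\<^sup>2 - frontal_K f \<nu> q)
     else frontal_H f \<nu> q - sqrt ((frontal_H f \<nu> q)\<^sup>2 - frontal_K f \<nu> q))"

definition limiting_normal_curvature ::
  "(real^2 \<Rightarrow> real^3) \<Rightarrow> (real^2 \<Rightarrow> real^3) \<Rightarrow> real \<Rightarrow> real" where
  "limiting_normal_curvature f \<nu> u = tL f \<nu> (vector [u, 0])"

definition cuspidal_torsion ::
  "(real^2 \<Rightarrow> real^3) \<Rightarrow> (real^2 \<Rightarrow> real^3) \<Rightarrow> real \<Rightarrow> real" where
  "cuspidal_torsion f \<nu> u = tM f \<nu> (vector [u, 0])"

definition focal_surface ::
  "nat \<Rightarrow> (real^2 \<Rightarrow> real^3) \<Rightarrow> (real^2 \<Rightarrow> real^3) \<Rightarrow> real^2 \<Rightarrow> real^3" where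
  "focal_surface j f \<nu> q = f q + (1 / principal_curvature j f \<nu> q) *\<^sub>R \<nu> q"


section \<open>Gaussian curvature of a regular surface\<close>

text \<open>Where the parametrisation \<open>X\<close> is not an immersion, the values below are not meaningful and
  \<open>gaussian_curvature X q = 0\<close> by the convention for division.\<close>

definition surface_normal :: "(real^2 \<Rightarrow> real^3) \<Rightarrow> real^2 \<Rightarrow> real^3" where
  "surface_normal X q =
    (1 / norm (cross3 (pd 1 X q) (pd 2 X q))) *\<^sub>R cross3 (pd 1 X q) (pd 2 X q)"

definition gaussian_curvature :: "(real^2 \<Rightarrow> real^3) \<Rightarrow> real^2 \<Rightarrow> real" where
  "gaussian_curvature X q =
    (let n = surface_normal X q;
         E = pd 1 X q \<bullet> pd 1 X q;
         F = pd 1 X q \<bullet> pd 2 X q;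
         G = pd 2 X q \<bullet> pd 2 X q;
         L = pd 1 (pd 1 X) q \<bullet> n;
         M = pd 2 (pd 1 X) q \<bullet> n;
         N = pd 2 (pd 2 X) q \<bullet> n
     in (L * N - M\<^sup>2) / (E * G - F\<^sup>2))"

end

theory Submission
  imports Defs
begin

text \<open>
  Write $g$, $n$ for the frontal and its unit normal in adapted coordinates, $g_v = v h$,
  $n_v = v m$, and $\kappa = \kappa_j$, $\rho = 1/\kappa$, $C = g + \rho n$.

  The computation at the origin is short. There $g_u, h, n$ is an orthonormal frame, and
  $g_{uv}$, $n_{uv}$, $n_v$ vanish because they are multiples of $v$. Hence $C_v = \rho_v n$, and
  modulo $n$ the vector $C_u$ is $x g_u + y h$ with $x = 1 - \rho \kappa_\nu$,
  $y = - \rho \kappa_t$. The normal of $C$ is therefore parallel to $y g_u - x h$. The component of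
  $C_{vv}$ along it vanishes, because $\kappa$ is an eigenvalue of the matrix of
  $\tilde L, \tilde M, \tilde N_1$, so that $C_{uu}$ does not enter the Gaussian curvature. Since
  $C_{uv} = \rho_v n_u$ modulo $n$, the remaining term is $- \kappa_t^2 / (x^2 + y^2)^2$: the
  factors $\rho_v$ cancel. This is \<open>focal_gaussian_curvature\<close>.

  It requires $\rho_v \neq 0$ at the origin, which is what makes $C$ an immersion and where the
  type of the singularity enters. Differentiating the equation
  $(\tilde L - \kappa \tilde E)(\tilde N_1 - \kappa \tilde G) = (\tilde M - \kappa \tilde F)^2$
  along $v$ shows that $\kappa_v$ is a nonzero multiple of a quantity that no longer involves
  $\kappa$, called \<open>secondary_curvature\<close> below (\<open>dv_principal_curvature\<close>).
  To see that it is not zero, use the diffeomorphism $\tau$ of the target and the diffeomorphism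
  of the source that bring the map to the form $(u, v^2, v^5)$. If $y$ is the second source
  coordinate of that normal form, then $\tau_2 \circ g = y^2$ and $\tau_3 \circ g = y^5$, so that
  $\nabla \tau_3 - \frac{5}{2} y^3 \nabla \tau_2$, taken at $g$, is orthogonal to the image of
  $dg$ and thus a multiple of $n$. Its derivatives along $v$ yield both that $n_v = 0$ on the
  $u$-axis (\<open>axis_stationary\<close>), so that $m$ exists, and an explicit nonzero value of
  the secondary curvature (\<open>secondary_curvature_eq\<close>): all contributions of the Hessian of
  $\tau_3$ cancel, and a multiple of the fifth power of $y_v$ remains.

  The analytic tools are the stability of the class of smooth maps under the usual operations,
  Hadamard's lemma, which divides a smooth map that vanishes on the $u$-axis by $v$, and the
  symmetry of second derivatives, which is deduced from it.
\<close>

section \<open>Maps of class $C^k$\<close>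

text \<open>The point is the last argument, so that the directional derivative of a map is a map again and
  iterated derivatives are iterated applications.\<close>

definition dirD :: "'a::euclidean_space \<Rightarrow> ('a \<Rightarrow> 'b::euclidean_space) \<Rightarrow> 'a \<Rightarrow> 'b" where
  "dirD w f x = frechet_derivative f (at x) w"

lemma has_derivative_dirD:
  "f differentiable (at x) \<Longrightarrow> (f has_derivative (\<lambda>w. dirD w f x)) (at x)"
  unfolding dirD_def using frechet_derivative_works[of f "at x"] by simp

lemma dirD_eq: "(f has_derivative f') (at x) \<Longrightarrow> dirD w f x = f' w"
  unfolding dirD_def using frechet_derivative_at by metis

lemma dirD_linear: "f differentiable (at x) \<Longrightarrow> linear (\<lambda>w. dirD w f x)"
  using has_derivative_dirD has_derivative_linear by blast

lemma dirD_combination: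
  assumes "f differentiable (at x)"
  shows "dirD (a *\<^sub>R v + b *\<^sub>R w) f x = a *\<^sub>R dirD v f x + b *\<^sub>R dirD w f x"
  using linear_add[OF dirD_linear[OF assms]] linear_cmul[OF dirD_linear[OF assms]] by simp

text \<open>The derivative is defined by choice from a predicate that depends on the germ only, so the
  equality extends to maps without a derivative.\<close>

lemma frechet_derivative_cong_nhds:
  assumes "\<forall>\<^sub>F y in nhds x. f y = g y"
  shows "frechet_derivative f (at x) = frechet_derivative g (at x)"
proof -
  have ev: "\<forall>\<^sub>F y in at x. f y = g y" and eq: "f x = g x"
    using assms by (auto simp: eventually_nhds_conv_at)
  have "(f has_derivative f') (at x) \<longleftrightarrow> (g has_derivative f') (at x)" for f'
    using has_derivative_transform_eventually[OF _ ev eq]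
      has_derivative_transform_eventually[of g f' x UNIV f] ev eq
    by (auto simp: eq_commute)
  then show ?thesis
    unfolding frechet_derivative_def by simp
qed

lemma dirD_cong_nhds: "\<forall>\<^sub>F y in nhds x. F y = H y \<Longrightarrow> dirD w F x = dirD w H x"
  unfolding dirD_def using frechet_derivative_cong_nhds by metis

lemma dirD_cong:
  assumes "open S" "x \<in> S" "\<And>y. y \<in> S \<Longrightarrow> f y = g y"
  shows "dirD w f x = dirD w g x"
  using assms eventually_nhds by (intro dirD_cong_nhds) blast

lemma Ck_on_Suc:
  "Ck_on (Suc k) S f \<longleftrightarrow> (\<forall>x\<in>S. f differentiable (at x)) \<and> (\<forall>w. Ck_on k S (dirD w f))"
  by (simp add: dirD_def[abs_def])

text \<open>On an open set the value of each derivative at a point is determined by the values nearby, so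
  the class only depends on the restriction of the map.\<close>

lemma Ck_on_cong:
  assumes "open S" "\<And>x. x \<in> S \<Longrightarrow> f x = g x" "Ck_on k S f"
  shows "Ck_on k S g"
  using assms(2,3)
proof (induction k arbitrary: f g)
  case 0
  then show ?case by (simp cong: continuous_on_cong)
next
  case (Suc k)
  have "g differentiable (at x)" if "x \<in> S" for x
  proof -
    have "(f has_derivative (\<lambda>w. dirD w f x)) (at x)"
      using Suc.prems(2) that has_derivative_dirD[of f x] unfolding Ck_on_Suc by blast
    then have "(g has_derivative (\<lambda>w. dirD w f x)) (at x)"
      using has_derivative_transform_within_open[OF _ assms(1) that] Suc.prems(1) by blast
    then show ?thesis using differentiableI by blast
  qed
  moreover have "Ck_on k S (dirD w g)" for w
  proof (rule Suc.IH)
    show "dirD w f x = dirD w g x" if "x \<in> S" for x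
      by (rule dirD_cong[OF assms(1) that Suc.prems(1)])
    show "Ck_on k S (dirD w f)"
      using Suc.prems(2) unfolding Ck_on_Suc by blast
  qed
  ultimately show ?case by (simp add: Ck_on_Suc del: Ck_on.simps)
qed

text \<open>The way in which all closure properties below are proved: any formula for the derivative can
  take the place of the derivative itself.\<close>

lemma Ck_on_SucI:
  assumes "open S" "\<And>x. x \<in> S \<Longrightarrow> (f has_derivative (\<lambda>w. D w x)) (at x)"
    and "\<And>w. Ck_on k S (D w)"
  shows "Ck_on (Suc k) S f"
proof -
  have "Ck_on k S (dirD w f)" for w
    using assms(3)[of w] by (rule Ck_on_cong[OF assms(1), rotated]) (simp add: dirD_eq[OF assms(2)])
  then show ?thesis
    using assms(2) unfolding Ck_on_Suc by (blast intro: differentiableI)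
qed

lemma Ck_on_SucD: "Ck_on (Suc k) S f \<Longrightarrow> Ck_on k S f"
proof (induction k arbitrary: f)
  case 0
  then show ?case
    by (auto simp: Ck_on_Suc intro!: continuous_at_imp_continuous_on differentiable_imp_continuous_within)
next
  case (Suc k)
  then show ?case by (metis Ck_on_Suc)
qed

lemma Ck_on_continuous_on: "Ck_on k S f \<Longrightarrow> continuous_on S f"
proof (induction k)
  case (Suc k)
  then show ?case using Ck_on_SucD by blast
qed simp

lemma Ck_on_subset: "Ck_on k S f \<Longrightarrow> T \<subseteq> S \<Longrightarrow> Ck_on k T f"
  by (induction k arbitrary: f) (auto intro: continuous_on_subset)

lemma Ck_on_const: "open S \<Longrightarrow> Ck_on k S (\<lambda>x. c)"
proof (induction k arbitrary: c)
  case (Suc k)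
  show ?case
    by (rule Ck_on_SucI[where D = "\<lambda>w x. 0"]) (use Suc in \<open>auto simp del: Ck_on.simps\<close>)
qed simp

lemma Ck_on_bounded_linear:
  assumes "open S" "bounded_linear L"
  shows "Ck_on k S f \<Longrightarrow> Ck_on k S (\<lambda>x. L (f x))"
proof (induction k arbitrary: f)
  case 0
  then show ?case using assms by (auto intro: bounded_linear.continuous_on)
next
  case (Suc k)
  show ?case
  proof (rule Ck_on_SucI[where D = "\<lambda>w x. L (dirD w f x)"])
    show "((\<lambda>x. L (f x)) has_derivative (\<lambda>w. L (dirD w f x))) (at x)" if "x \<in> S" for x
      using bounded_linear.has_derivative[OF assms(2) has_derivative_dirD] Suc.prems that
      unfolding Ck_on_Suc by blast
  qed (use assms Suc in \<open>auto simp: Ck_on_Suc simp del: Ck_on.simps\<close>)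
qed

lemma Ck_on_ident: "open S \<Longrightarrow> Ck_on k S (\<lambda>x. x)"
proof (cases k)
  case (Suc m)
  assume "open S"
  then show ?thesis
    unfolding Suc by (intro Ck_on_SucI[where D = "\<lambda>w x. w"] Ck_on_const) auto
qed (simp add: continuous_on_id)

lemma Ck_on_add:
  assumes "open S"
  shows "Ck_on k S f \<Longrightarrow> Ck_on k S g \<Longrightarrow> Ck_on k S (\<lambda>x. f x + g x)"
proof (induction k arbitrary: f g)
  case 0
  then show ?case by (auto intro: continuous_intros)
next
  case (Suc k)
  show ?case
    by (rule Ck_on_SucI[where D = "\<lambda>w x. dirD w f x + dirD w g x"])
      (use assms Suc in \<open>auto simp: Ck_on_Suc simp del: Ck_on.simps intro!: has_derivative_add has_derivative_dirD\<close>)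
qed

lemma Ck_on_sum:
  assumes "open S" "finite I" "\<And>i. i \<in> I \<Longrightarrow> Ck_on k S (f i)"
  shows "Ck_on k S (\<lambda>x. \<Sum>i\<in>I. f i x)"
  using assms(2,3)
  by (induction I rule: finite_induct) (auto simp: assms(1) Ck_on_const Ck_on_add)

text \<open>Covers products, scalar multiples and inner products at once. The product rule needs the factors
  themselves to be of class $C^k$ in order to apply the induction hypothesis to
  $b(f, Dg) + b(Df, g)$.\<close>

lemma Ck_on_bilinear:
  assumes "open S" "bounded_bilinear b"
  shows "Ck_on k S f \<Longrightarrow> Ck_on k S g \<Longrightarrow> Ck_on k S (\<lambda>x. b (f x) (g x))"
proof (induction k arbitrary: f g)
  case 0
  then show ?case using assms by (auto intro: bounded_bilinear.continuous_on)
next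
  case (Suc k)
  show ?case
  proof (rule Ck_on_SucI[where D = "\<lambda>w x. b (f x) (dirD w g x) + b (dirD w f x) (g x)"])
    show "((\<lambda>x. b (f x) (g x)) has_derivative (\<lambda>w. b (f x) (dirD w g x) + b (dirD w f x) (g x))) (at x)"
      if "x \<in> S" for x
      using Suc.prems that unfolding Ck_on_Suc
      by (intro bounded_bilinear.FDERIV[OF assms(2)] has_derivative_dirD) auto
    show "Ck_on k S (\<lambda>x. b (f x) (dirD w g x) + b (dirD w f x) (g x))" for w
      using Suc Ck_on_SucD[of k S f] Ck_on_SucD[of k S g] assms(1)
      by (intro Ck_on_add) (auto simp: Ck_on_Suc simp del: Ck_on.simps)
  qed (rule assms)
qed

lemma dirD_Basis:
  assumes "f differentiable (at x)"
  shows "dirD w f x = (\<Sum>b\<in>Basis. (w \<bullet> b) *\<^sub>R dirD b f x)"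
proof -
  interpret linear "\<lambda>w. dirD w f x" by (rule dirD_linear[OF assms])
  have "dirD w f x = dirD (\<Sum>b\<in>Basis. (w \<bullet> b) *\<^sub>R b) f x"
    by (simp add: euclidean_representation)
  also have "\<dots> = (\<Sum>b\<in>Basis. (w \<bullet> b) *\<^sub>R dirD b f x)"
    by (simp add: sum scaleR)
  finally show ?thesis .
qed

lemma has_derivative_compose_dirD:
  assumes "f differentiable (at x)" "g differentiable (at (f x))"
  shows "((\<lambda>x. g (f x)) has_derivative (\<lambda>w. dirD (dirD w f x) g (f x))) (at x)"
  using has_derivative_compose[OF has_derivative_dirD[OF assms(1)], of g "\<lambda>w. dirD w g (f x)"]
    has_derivative_dirD[OF assms(2)] by (simp add: o_def)

text \<open>By the chain rule $D(g \circ f)$ is a sum, over a basis, of products of components of $Df$ with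
  partial derivatives of $g$ composed with $f$. The induction is over $g$ with $f$ fixed, so the
  induction hypothesis applies to these composites.\<close>

lemma Ck_on_compose:
  assumes "open S" "open T" "\<And>x. x \<in> S \<Longrightarrow> f x \<in> T"
  shows "Ck_on k S f \<Longrightarrow> Ck_on k T g \<Longrightarrow> Ck_on k S (\<lambda>x. g (f x))"
proof (induction k arbitrary: g)
  case 0
  then show ?case using assms(3) continuous_on_compose2[of T g S f] by auto
next
  case (Suc k)
  show ?case
  proof (rule Ck_on_SucI[where D = "\<lambda>w x. \<Sum>b\<in>Basis. (dirD w f x \<bullet> b) *\<^sub>R dirD b g (f x)"])
    show "((\<lambda>x. g (f x)) has_derivative (\<lambda>w. \<Sum>b\<in>Basis. (dirD w f x \<bullet> b) *\<^sub>R dirD b g (f x))) (at x)"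
      if "x \<in> S" for x
    proof -
      have "f differentiable (at x)" "g differentiable (at (f x))"
        using Suc.prems that assms(3) unfolding Ck_on_Suc by auto
      from has_derivative_compose_dirD[OF this] show ?thesis
        by (simp only: dirD_Basis[OF \<open>g differentiable (at (f x))\<close>, of "dirD w f x" for w])
    qed
    show "Ck_on k S (\<lambda>x. \<Sum>b\<in>Basis. (dirD w f x \<bullet> b) *\<^sub>R dirD b g (f x))" for w
    proof (intro Ck_on_sum[OF assms(1)] Ck_on_bilinear[OF assms(1) bounded_bilinear_scaleR])
      fix b :: 'b
      show "Ck_on k S (\<lambda>x. dirD w f x \<bullet> b)"
        using Suc.prems by (intro Ck_on_bounded_linear[OF assms(1) bounded_linear_inner_left])
          (simp add: Ck_on_Suc del: Ck_on.simps)
      show "Ck_on k S (\<lambda>x. dirD b g (f x))"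
        using Suc.prems Ck_on_SucD[OF Suc.prems(1)]
        by (intro Suc.IH) (simp_all add: Ck_on_Suc del: Ck_on.simps)
    qed simp
  qed (rule assms)
qed

text \<open>The derivative $-Df \cdot f^{-1} \cdot f^{-1}$ is a product of maps of class $C^k$ by the
  induction hypothesis itself.\<close>

lemma Ck_on_inverse:
  fixes f :: "'a::euclidean_space \<Rightarrow> real"
  assumes "open S" "\<And>x. x \<in> S \<Longrightarrow> f x \<noteq> 0"
  shows "Ck_on k S f \<Longrightarrow> Ck_on k S (\<lambda>x. inverse (f x))"
proof (induction k)
  case 0
  then show ?case using assms by (auto intro: continuous_intros)
next
  case (Suc k)
  have D: "((\<lambda>x. inverse (f x)) has_derivative
      (\<lambda>w. (- dirD w f x) * (inverse (f x) * inverse (f x)))) (at x)" if "x \<in> S" for x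
    using Suc.prems that assms(2) unfolding Ck_on_Suc
    by (auto intro!: derivative_eq_intros has_derivative_dirD)
  have inv: "Ck_on k S (\<lambda>x. inverse (f x))"
    using Suc.IH Ck_on_SucD[OF Suc.prems] .
  have neg: "Ck_on k S (\<lambda>x. - dirD w f x)" for w
    using Suc.prems by (intro Ck_on_bounded_linear[OF assms(1) bounded_linear_minus[OF bounded_linear_ident]])
      (simp add: Ck_on_Suc del: Ck_on.simps)
  show ?case
    by (rule Ck_on_SucI[OF assms(1) D], assumption)
      (intro Ck_on_bilinear[OF assms(1) bounded_bilinear_mult] inv neg)
qed

lemma Ck_on_sqrt:
  fixes f :: "'a::euclidean_space \<Rightarrow> real"
  assumes "open S" "\<And>x. x \<in> S \<Longrightarrow> f x > 0"
  shows "Ck_on k S f \<Longrightarrow> Ck_on k S (\<lambda>x. sqrt (f x))"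
proof (induction k)
  case 0
  then show ?case by (auto intro: continuous_intros)
next
  case (Suc k)
  have D: "((\<lambda>x. sqrt (f x)) has_derivative
      (\<lambda>w. dirD w f x * (inverse (sqrt (f x)) * inverse 2))) (at x)" if "x \<in> S" for x
    using Suc.prems that assms(2)[OF that] unfolding Ck_on_Suc
    by (auto intro!: derivative_eq_intros has_derivative_dirD simp: divide_simps)
  have inv: "Ck_on k S (\<lambda>x. inverse (sqrt (f x)))"
    using Suc.IH Ck_on_SucD[OF Suc.prems] assms(2)
    by (intro Ck_on_inverse[OF assms(1)]) (auto simp: less_imp_neq[THEN not_sym])
  show ?case
    by (rule Ck_on_SucI[OF assms(1) D], assumption,
        intro Ck_on_bilinear[OF assms(1) bounded_bilinear_mult] inv Ck_on_const[OF assms(1)])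
      (use Suc.prems in \<open>simp add: Ck_on_Suc del: Ck_on.simps\<close>)
qed

section \<open>Smooth maps\<close>

lemma smooth_on_iff:
  "smooth_on S f \<longleftrightarrow> (\<forall>x\<in>S. f differentiable (at x)) \<and> (\<forall>w. smooth_on S (dirD w f))"
proof
  assume f: "smooth_on S f"
  then have "Ck_on (Suc k) S f" for k unfolding smooth_on_def by blast
  then show "(\<forall>x\<in>S. f differentiable (at x)) \<and> (\<forall>w. smooth_on S (dirD w f))"
    unfolding smooth_on_def Ck_on_Suc by blast
next
  assume f: "(\<forall>x\<in>S. f differentiable (at x)) \<and> (\<forall>w. smooth_on S (dirD w f))"
  then have "Ck_on (Suc k) S f" for k unfolding smooth_on_def Ck_on_Suc by blast
  then show "smooth_on S f"
    unfolding smooth_on_def using Ck_on_SucD by blast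
qed

lemma smooth_on_differentiable: "smooth_on S f \<Longrightarrow> x \<in> S \<Longrightarrow> f differentiable (at x)"
  using smooth_on_iff by blast

lemma smooth_on_dirD: "smooth_on S f \<Longrightarrow> smooth_on S (dirD w f)"
  using smooth_on_iff by blast

lemma smooth_on_continuous_on: "smooth_on S f \<Longrightarrow> continuous_on S f"
  unfolding smooth_on_def using Ck_on.simps(1) by blast

lemma smooth_on_cong:
  "open S \<Longrightarrow> (\<And>x. x \<in> S \<Longrightarrow> f x = g x) \<Longrightarrow> smooth_on S f \<Longrightarrow> smooth_on S g"
  unfolding smooth_on_def using Ck_on_cong by blast

lemma smooth_on_subset: "smooth_on S f \<Longrightarrow> T \<subseteq> S \<Longrightarrow> smooth_on T f"
  unfolding smooth_on_def using Ck_on_subset by blast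

lemma smooth_on_bounded_linear:
  "open S \<Longrightarrow> bounded_linear L \<Longrightarrow> smooth_on S f \<Longrightarrow> smooth_on S (\<lambda>x. L (f x))"
  unfolding smooth_on_def using Ck_on_bounded_linear by blast

lemma smooth_on_bilinear:
  "open S \<Longrightarrow> bounded_bilinear b \<Longrightarrow> smooth_on S f \<Longrightarrow> smooth_on S g \<Longrightarrow> smooth_on S (\<lambda>x. b (f x) (g x))"
  unfolding smooth_on_def using Ck_on_bilinear by blast

lemma smooth_on_compose:
  "open S \<Longrightarrow> open T \<Longrightarrow> (\<And>x. x \<in> S \<Longrightarrow> f x \<in> T) \<Longrightarrow> smooth_on S f \<Longrightarrow> smooth_on T g \<Longrightarrow>
    smooth_on S (\<lambda>x. g (f x))"
  unfolding smooth_on_def using Ck_on_compose by blast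

lemma smooth_on_const: "open S \<Longrightarrow> smooth_on S (\<lambda>x. c)"
  unfolding smooth_on_def using Ck_on_const by blast

lemma smooth_on_ident: "open S \<Longrightarrow> smooth_on S (\<lambda>x. x)"
  unfolding smooth_on_def using Ck_on_ident by blast

lemma smooth_on_add: "open S \<Longrightarrow> smooth_on S f \<Longrightarrow> smooth_on S g \<Longrightarrow> smooth_on S (\<lambda>x. f x + g x)"
  unfolding smooth_on_def using Ck_on_add by blast

lemma smooth_on_sum:
  "open S \<Longrightarrow> finite I \<Longrightarrow> (\<And>i. i \<in> I \<Longrightarrow> smooth_on S (f i)) \<Longrightarrow> smooth_on S (\<lambda>x. \<Sum>i\<in>I. f i x)"
  unfolding smooth_on_def using Ck_on_sum by blast

lemma smooth_on_inverse:
  fixes f :: "'a::euclidean_space \<Rightarrow> real"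
  shows "open S \<Longrightarrow> (\<And>x. x \<in> S \<Longrightarrow> f x \<noteq> 0) \<Longrightarrow> smooth_on S f \<Longrightarrow> smooth_on S (\<lambda>x. inverse (f x))"
  unfolding smooth_on_def using Ck_on_inverse by blast

lemma smooth_on_sqrt:
  fixes f :: "'a::euclidean_space \<Rightarrow> real"
  shows "open S \<Longrightarrow> (\<And>x. x \<in> S \<Longrightarrow> f x > 0) \<Longrightarrow> smooth_on S f \<Longrightarrow> smooth_on S (\<lambda>x. sqrt (f x))"
  unfolding smooth_on_def using Ck_on_sqrt by blast

lemmas smooth_on_scaleR = smooth_on_bilinear[OF _ bounded_bilinear_scaleR]
lemmas smooth_on_inner = smooth_on_bilinear[OF _ bounded_bilinear_inner]

lemma smooth_on_mult:
  fixes f g :: "'a::euclidean_space \<Rightarrow> real"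
  shows "open S \<Longrightarrow> smooth_on S f \<Longrightarrow> smooth_on S g \<Longrightarrow> smooth_on S (\<lambda>x. f x * g x)"
  by (rule smooth_on_bilinear[OF _ bounded_bilinear_mult])

lemma smooth_on_minus: "open S \<Longrightarrow> smooth_on S f \<Longrightarrow> smooth_on S (\<lambda>x. - f x)"
  by (rule smooth_on_bounded_linear[OF _ bounded_linear_minus[OF bounded_linear_ident]])

lemma smooth_on_diff: "open S \<Longrightarrow> smooth_on S f \<Longrightarrow> smooth_on S g \<Longrightarrow> smooth_on S (\<lambda>x. f x - g x)"
  using smooth_on_add[OF _ _ smooth_on_minus, of S f g] by simp

lemma smooth_on_power:
  fixes f :: "'a::euclidean_space \<Rightarrow> real"
  shows "open S \<Longrightarrow> smooth_on S f \<Longrightarrow> smooth_on S (\<lambda>x. f x ^ n)"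
  by (induction n) (auto intro: smooth_on_const smooth_on_mult)

lemma smooth_on_divide:
  fixes f g :: "'a::euclidean_space \<Rightarrow> real"
  shows "open S \<Longrightarrow> (\<And>x. x \<in> S \<Longrightarrow> g x \<noteq> 0) \<Longrightarrow> smooth_on S f \<Longrightarrow> smooth_on S g \<Longrightarrow>
    smooth_on S (\<lambda>x. f x / g x)"
  unfolding divide_inverse by (intro smooth_on_mult smooth_on_inverse)

lemma smooth_on_nth:
  fixes f :: "'a::euclidean_space \<Rightarrow> real^'n"
  shows "open S \<Longrightarrow> smooth_on S f \<Longrightarrow> smooth_on S (\<lambda>x. f x $ i)"
  by (rule smooth_on_bounded_linear[OF _ bounded_linear_vec_nth])

lemmas smooth_intros = smooth_on_const smooth_on_ident smooth_on_add smooth_on_diff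
  smooth_on_minus smooth_on_scaleR smooth_on_inner smooth_on_mult smooth_on_power smooth_on_nth
  smooth_on_dirD

section \<open>Rules for directional derivatives\<close>

lemma dirD_zero: "F differentiable (at x) \<Longrightarrow> dirD 0 F x = 0"
  using linear_0[OF dirD_linear] .

lemma dirD_const [simp]: "dirD w (\<lambda>x. c) x = 0"
  by (simp add: dirD_def)

lemma dirD_bounded_linear:
  assumes "bounded_linear L" "f differentiable (at x)"
  shows "dirD w (\<lambda>x. L (f x)) x = L (dirD w f x)"
  by (rule dirD_eq[OF bounded_linear.has_derivative[OF assms(1) has_derivative_dirD[OF assms(2)]]])

lemma dirD_nth:
  fixes f :: "'a::euclidean_space \<Rightarrow> real^'n"
  shows "f differentiable (at x) \<Longrightarrow> dirD w (\<lambda>x. f x $ i) x = dirD w f x $ i"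
  by (rule dirD_bounded_linear[OF bounded_linear_vec_nth])

lemma dirD_coordinate: "dirD w (\<lambda>q. q $ i) q = w $ i"
  by (rule dirD_eq[OF bounded_linear_imp_has_derivative[OF bounded_linear_vec_nth]])

lemma dirD_add:
  "f differentiable (at x) \<Longrightarrow> g differentiable (at x) \<Longrightarrow>
    dirD w (\<lambda>x. f x + g x) x = dirD w f x + dirD w g x"
  by (rule dirD_eq) (intro has_derivative_add has_derivative_dirD)

lemma dirD_diff:
  "f differentiable (at x) \<Longrightarrow> g differentiable (at x) \<Longrightarrow>
    dirD w (\<lambda>x. f x - g x) x = dirD w f x - dirD w g x"
  by (rule dirD_eq) (intro has_derivative_diff has_derivative_dirD)

lemma dirD_bilinear:
  assumes "bounded_bilinear b" "f differentiable (at x)" "g differentiable (at x)"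
  shows "dirD w (\<lambda>x. b (f x) (g x)) x = b (f x) (dirD w g x) + b (dirD w f x) (g x)"
  by (rule dirD_eq)
    (intro bounded_bilinear.FDERIV[OF assms(1)] has_derivative_dirD assms(2,3))

lemmas dirD_scaleR = dirD_bilinear[OF bounded_bilinear_scaleR]
lemmas dirD_inner = dirD_bilinear[OF bounded_bilinear_inner]

lemma dirD_mult:
  fixes f g :: "'a::euclidean_space \<Rightarrow> real"
  shows "f differentiable (at x) \<Longrightarrow> g differentiable (at x) \<Longrightarrow>
    dirD w (\<lambda>x. f x * g x) x = f x * dirD w g x + dirD w f x * g x"
  by (rule dirD_bilinear[OF bounded_bilinear_mult])

lemma dirD_power:
  fixes f :: "'a::euclidean_space \<Rightarrow> real"
  assumes "f differentiable (at x)"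
  shows "dirD w (\<lambda>x. f x ^ n) x = of_nat n * f x ^ (n - 1) * dirD w f x"
  by (rule dirD_eq[OF has_derivative_eq_rhs[OF has_derivative_power[OF has_derivative_dirD[OF assms]]]])
    (simp add: fun_eq_iff algebra_simps)

lemma dirD_chain:
  assumes "f differentiable (at x)" "g differentiable (at (f x))"
  shows "dirD w (\<lambda>x. g (f x)) x = dirD (dirD w f x) g (f x)"
  by (rule dirD_eq[OF has_derivative_compose_dirD[OF assms]])

lemma pd_eq_dirD: "pd i f = dirD (axis i 1) f"
  by (simp add: pd_def dirD_def fun_eq_iff)

lemma differentiable_intros:
  fixes f :: "'a::euclidean_space \<Rightarrow> 'b::euclidean_space"
  assumes "smooth_on S f" "x \<in> S"
  shows "f differentiable (at x)" "dirD w f differentiable (at x)"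
  using assms smooth_on_differentiable smooth_on_dirD by blast+

abbreviation du :: "(real^2 \<Rightarrow> 'b::euclidean_space) \<Rightarrow> real^2 \<Rightarrow> 'b" where
  "du \<equiv> dirD (axis 1 1)"

abbreviation dv :: "(real^2 \<Rightarrow> 'b::euclidean_space) \<Rightarrow> real^2 \<Rightarrow> 'b" where
  "dv \<equiv> dirD (axis 2 1)"

lemmas dirD_rules = dirD_add dirD_diff dirD_scaleR dirD_inner dirD_mult dirD_coordinate

lemma differentiable_coordinate [simp]: "(\<lambda>q::real^'n. q $ i) differentiable F"
  using bounded_linear_imp_differentiable[OF bounded_linear_vec_nth] .

lemma axis_simps [simp]: "axis 1 1 $ (2::2) = (0::real)" "axis 2 1 $ (2::2) = (1::real)"
  "axis 2 1 $ (1::2) = (0::real)" "axis 1 1 $ (1::2) = (1::real)"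
  by (simp_all add: axis_def)

section \<open>Division by a coordinate\<close>

text \<open>$(u, v) \mapsto (u, t v)$. Being linear in the point and affine in $t$, this form lets
  continuity and differentiability be read off.\<close>

definition shrink2 :: "real \<Rightarrow> real^2 \<Rightarrow> real^2" where
  "shrink2 t q = q - ((1 - t) * q$2) *\<^sub>R axis 2 1"

lemma shrink2_1 [simp]: "shrink2 1 q = q"
  by (simp add: shrink2_def)

lemma shrink2_nth [simp]: "shrink2 t q $ 1 = q $ 1" "shrink2 t q $ 2 = t * q $ 2"
  by (simp_all add: shrink2_def axis_def algebra_simps)

lemma shrink2_in_ball:
  assumes "q \<in> ball 0 r" "0 \<le> t" "t \<le> 1"
  shows "shrink2 t q \<in> ball 0 r"
proof -
  have "\<bar>shrink2 t q $ i\<bar> \<le> \<bar>q $ i\<bar>" for i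
    using assms(2,3) exhaust_2[of i] by (auto simp: abs_mult mult_left_le_one_le)
  then have "norm (shrink2 t q) \<le> norm q"
    by (intro norm_le_componentwise_cart) simp
  then show ?thesis using assms(1) by simp
qed

lemma bounded_linear_shrink2: "bounded_linear (shrink2 t)"
  unfolding shrink2_def by (intro bounded_linear_intros bounded_linear_vec_nth)

lemma continuous_on_shrink2: "continuous_on T (\<lambda>t. shrink2 t q)"
  unfolding shrink2_def by (intro continuous_intros)

text \<open>The quotient in Hadamard's lemma is $\int_0^1 F_v(u, tv)\, dt$. Differentiating such an integral
  along $v$ produces a further factor $t$, so the weight $t^m$ makes the family of these integrals
  closed under differentiation.\<close>

definition ray_average :: "nat \<Rightarrow> (real^2 \<Rightarrow> 'b::euclidean_space) \<Rightarrow> real^2 \<Rightarrow> 'b" where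
  "ray_average m F q = integral (cbox 0 1) (\<lambda>t. t ^ m *\<^sub>R F (shrink2 t q))"

text \<open>Differentiation under the integral sign over the compact interval.\<close>

lemma has_derivative_ray_average:
  fixes F :: "real^2 \<Rightarrow> 'b::euclidean_space"
  assumes F: "Ck_on (Suc k) (ball 0 r) F" and q: "q \<in> ball 0 r"
  shows "(ray_average m F has_derivative
    (\<lambda>w. w$1 *\<^sub>R ray_average m (dirD (axis 1 1) F) q +
         w$2 *\<^sub>R ray_average (Suc m) (dirD (axis 2 1) F) q)) (at q)"
proof -
  have diff: "F differentiable (at x)" if "x \<in> ball 0 r" for x
    using F that unfolding Ck_on_Suc by blast
  have contD: "continuous_on (ball 0 r) (dirD w F)" for w
    using F Ck_on_continuous_on unfolding Ck_on_Suc by blast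
  have contF: "continuous_on (ball 0 r) F"
    using F by (rule Ck_on_continuous_on)
  define D where "D x t = Blinfun (\<lambda>w. t ^ m *\<^sub>R dirD (shrink2 t w) F (shrink2 t x))" for x t
  have bl: "bounded_linear (\<lambda>w. t ^ m *\<^sub>R dirD (shrink2 t w) F (shrink2 t x))"
    if "x \<in> ball 0 r" "t \<in> cbox 0 1" for x t
    using bounded_linear_compose[OF _ bounded_linear_shrink2[of t],
        of "\<lambda>w. dirD w F (shrink2 t x)"] that
      has_derivative_dirD[OF diff[OF shrink2_in_ball[of x r t]]]
    by (intro bounded_linear_intros) (auto dest: has_derivative_bounded_linear)
  have D: "blinfun_apply (D x t) = (\<lambda>w. t ^ m *\<^sub>R dirD (shrink2 t w) F (shrink2 t x))"
    if "x \<in> ball 0 r" "t \<in> cbox 0 1" for x t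
    unfolding D_def using bl[OF that] by (rule bounded_linear_Blinfun_apply)
  have split: "dirD (shrink2 t w) F (shrink2 t x) =
      w$1 *\<^sub>R dirD (axis 1 1) F (shrink2 t x) + (t * w$2) *\<^sub>R dirD (axis 2 1) F (shrink2 t x)"
    if "x \<in> ball 0 r" "t \<in> cbox 0 1" for x t w
  proof -
    have "shrink2 t w = w$1 *\<^sub>R axis 1 1 + (t * w$2) *\<^sub>R axis 2 1"
      by (simp add: vec_eq_iff forall_2 axis_def)
    then show ?thesis
      using dirD_combination[OF diff[OF shrink2_in_ball[of x r t]]] that by simp
  qed
  have contS: "continuous_on (ball 0 r \<times> cbox 0 1) (\<lambda>z. G (shrink2 (snd z) (fst z)))"
    if "continuous_on (ball 0 r) G" for G :: "real^2 \<Rightarrow> 'b"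
    using that
  proof (rule continuous_on_compose2)
    show "continuous_on (ball 0 r \<times> cbox 0 1) (\<lambda>z. shrink2 (snd z) (fst z))"
      unfolding shrink2_def by (intro continuous_intros)
    show "(\<lambda>z. shrink2 (snd z) (fst z)) ` (ball 0 r \<times> cbox 0 1) \<subseteq> ball 0 r"
      using shrink2_in_ball by force
  qed
  have slice: "(\<lambda>t. t ^ i *\<^sub>R G (shrink2 t x)) integrable_on cbox 0 1"
    if "continuous_on (ball 0 r) G" "x \<in> ball 0 r" for G :: "real^2 \<Rightarrow> 'b" and i x
  proof (rule integrable_continuous, intro continuous_intros)
    show "continuous_on (cbox 0 1) (\<lambda>t. G (shrink2 t x))"
      using that(1)
      by (rule continuous_on_compose2)
        (use that(2) in \<open>auto intro!: shrink2_in_ball continuous_on_shrink2\<close>)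
  qed
  have "((\<lambda>x. integral (cbox 0 1) (\<lambda>t. t ^ m *\<^sub>R F (shrink2 t x))) has_derivative
      blinfun_apply (integral (cbox 0 1) (D q))) (at q within ball 0 r)"
  proof (rule leibniz_rule[where fx = D and f = "\<lambda>x t. t ^ m *\<^sub>R F (shrink2 t x)"])
    fix x t assume xt: "x \<in> ball (0::real^2) r" "t \<in> cbox (0::real) 1"
    have *: "(shrink2 t has_derivative shrink2 t) (at x)"
      by (rule bounded_linear_imp_has_derivative[OF bounded_linear_shrink2])
    have "((\<lambda>x. F (shrink2 t x)) has_derivative (\<lambda>w. dirD (shrink2 t w) F (shrink2 t x))) (at x)"
      using has_derivative_compose[OF * has_derivative_dirD[OF diff[OF shrink2_in_ball[of x r t]]]] xt
      by simp
    from has_derivative_scaleR_right[OF this, of "t ^ m"]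
    show "((\<lambda>x. t ^ m *\<^sub>R F (shrink2 t x)) has_derivative blinfun_apply (D x t)) (at x within ball 0 r)"
      unfolding D[OF xt] by (rule has_derivative_at_withinI)
  next
    show "continuous_on (ball 0 r \<times> cbox 0 1) (\<lambda>(x, t). D x t)"
    proof (rule continuous_on_blinfun_componentwise)
      fix i :: "real^2"
      have "continuous_on (ball 0 r \<times> cbox 0 1)
        (\<lambda>z. snd z ^ m *\<^sub>R (i$1 *\<^sub>R dirD (axis 1 1) F (shrink2 (snd z) (fst z)) +
           (snd z * i$2) *\<^sub>R dirD (axis 2 1) F (shrink2 (snd z) (fst z))))"
        by (intro continuous_intros contS contD)
      then show "continuous_on (ball 0 r \<times> cbox 0 1) (\<lambda>x. blinfun_apply (case x of (x, t) \<Rightarrow> D x t) i)"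
        by (rule continuous_on_eq) (auto simp: D split)
    qed
  qed (use q slice[OF contF] in auto)
  moreover have "blinfun_apply (integral (cbox 0 1) (D q)) =
      (\<lambda>w. w$1 *\<^sub>R ray_average m (dirD (axis 1 1) F) q +
         w$2 *\<^sub>R ray_average (Suc m) (dirD (axis 2 1) F) q)"
  proof
    fix w :: "real^2"
    have "continuous_on (cbox 0 1) (D q)"
    proof (rule continuous_on_blinfun_componentwise)
      fix i :: "real^2"
      have cz: "continuous_on (cbox 0 1) (\<lambda>t. G (shrink2 t q))"
        if "continuous_on (ball 0 r) G" for G :: "real^2 \<Rightarrow> 'b"
        using that
        by (rule continuous_on_compose2)
          (use q in \<open>auto intro!: shrink2_in_ball continuous_on_shrink2\<close>)
      have "continuous_on (cbox 0 1)
        (\<lambda>t. t ^ m *\<^sub>R (i$1 *\<^sub>R dirD (axis 1 1) F (shrink2 t q) +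
           (t * i$2) *\<^sub>R dirD (axis 2 1) F (shrink2 t q)))"
        by (intro continuous_intros cz contD)
      then show "continuous_on (cbox 0 1) (\<lambda>t. blinfun_apply (D q t) i)"
        by (rule continuous_on_eq) (use q in \<open>auto simp: D split\<close>)
    qed
    then have "blinfun_apply (integral (cbox 0 1) (D q)) w = integral (cbox 0 1) (\<lambda>t. D q t w)"
      by (intro blinfun_apply_integral integrable_continuous)
    also have "\<dots> = integral (cbox 0 1) (\<lambda>t. w$1 *\<^sub>R (t ^ m *\<^sub>R dirD (axis 1 1) F (shrink2 t q)) +
         w$2 *\<^sub>R (t ^ Suc m *\<^sub>R dirD (axis 2 1) F (shrink2 t q)))"
      using q by (intro integral_cong) (simp add: D split algebra_simps)
    also have "\<dots> = w$1 *\<^sub>R ray_average m (dirD (axis 1 1) F) q +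
         w$2 *\<^sub>R ray_average (Suc m) (dirD (axis 2 1) F) q"
      unfolding ray_average_def
      by (simp only: integral_add[OF integrable_cmul[OF slice[OF contD q]]
            integrable_cmul[OF slice[OF contD q]]] integral_cmul)
    finally show "blinfun_apply (integral (cbox 0 1) (D q)) w =
      w$1 *\<^sub>R ray_average m (dirD (axis 1 1) F) q +
         w$2 *\<^sub>R ray_average (Suc m) (dirD (axis 2 1) F) q" .
  qed
  moreover have "at q within ball 0 r = at q"
    using q by (intro at_within_open) auto
  moreover have "ray_average m F = (\<lambda>x. integral (cbox 0 1) (\<lambda>t. t ^ m *\<^sub>R F (shrink2 t x)))"
    by (simp add: fun_eq_iff ray_average_def)
  ultimately show ?thesis by (simp only:)
qed

lemma Ck_on_ray_average:
  fixes F :: "real^2 \<Rightarrow> 'b::euclidean_space"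
  shows "Ck_on (Suc k) (ball 0 r) F \<Longrightarrow> Ck_on k (ball 0 r) (ray_average m F)"
proof (induction k arbitrary: F m)
  case 0
  show ?case
    unfolding Ck_on.simps(1)
    by (intro continuous_at_imp_continuous_on ballI
        has_derivative_continuous[OF has_derivative_ray_average[OF 0]])
next
  case (Suc k)
  show ?case
  proof (rule Ck_on_SucI[OF open_ball has_derivative_ray_average[OF Suc.prems]], assumption)
    fix w :: "real^2"
    have "Ck_on (Suc k) (ball 0 r) (dirD v F)" for v
      using Suc.prems unfolding Ck_on_Suc[of "Suc k"] by blast
    then show "Ck_on k (ball 0 r) (\<lambda>q. w$1 *\<^sub>R ray_average m (dirD (axis 1 1) F) q +
         w$2 *\<^sub>R ray_average (Suc m) (dirD (axis 2 1) F) q)"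
      by (intro Ck_on_add open_ball Suc.IH
          Ck_on_bounded_linear[OF open_ball bounded_linear_scaleR_right])
  qed
qed

text \<open>Integrate $\frac{d}{dt} F(u, tv) = v F_v(u, tv)$ over $0 \le t \le 1$.\<close>

lemma Hadamard:
  fixes F :: "real^2 \<Rightarrow> 'b::euclidean_space"
  assumes F: "smooth_on (ball 0 r) F"
  obtains k where "smooth_on (ball 0 r) k"
    and "\<And>q. q \<in> ball 0 r \<Longrightarrow> F q = F (shrink2 0 q) + q$2 *\<^sub>R k q"
proof
  let ?k = "ray_average 0 (dirD (axis 2 1) F)"
  show "smooth_on (ball 0 r) ?k"
    using smooth_on_dirD[OF F] Ck_on_ray_average unfolding smooth_on_def by blast
  fix q :: "real^2" assume q: "q \<in> ball 0 r"
  have "((\<lambda>t. F (shrink2 t q)) has_vector_derivative q$2 *\<^sub>R dirD (axis 2 1) F (shrink2 t q))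
      (at t within {0..1})" if "t \<in> {0..1}" for t
  proof -
    have d: "F differentiable (at (shrink2 t q))"
      using smooth_on_differentiable[OF F shrink2_in_ball[OF q]] that by auto
    have "((\<lambda>t. shrink2 t q) has_derivative (\<lambda>s. (s * q$2) *\<^sub>R axis 2 1)) (at t within {0..1})"
      unfolding shrink2_def by (auto intro!: derivative_eq_intros)
    from has_derivative_compose[OF this has_derivative_dirD[OF d]]
    show ?thesis
      unfolding has_vector_derivative_def
      using linear_cmul[OF dirD_linear[OF d]] by (simp add: o_def)
  qed
  then have "((\<lambda>t. q$2 *\<^sub>R dirD (axis 2 1) F (shrink2 t q)) has_integral
      F (shrink2 1 q) - F (shrink2 0 q)) {0..1}"
    by (intro fundamental_theorem_of_calculus) auto
  then have "F q - F (shrink2 0 q) = integral {0..1} (\<lambda>t. q$2 *\<^sub>R dirD (axis 2 1) F (shrink2 t q))"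
    unfolding shrink2_1 by (rule integral_unique[symmetric])
  also have "\<dots> = q$2 *\<^sub>R ?k q"
    by (simp add: ray_average_def)
  finally show "F q = F (shrink2 0 q) + q$2 *\<^sub>R ?k q"
    by (simp add: algebra_simps)
qed

section \<open>Symmetry of second derivatives\<close>

text \<open>With $G(u,v) = G(u,0) + v\,k(u,v)$, both mixed derivatives at the origin are equal to $k_u$.\<close>

lemma dirD_commute_plane:
  fixes G :: "real^2 \<Rightarrow> 'b::euclidean_space"
  assumes G: "smooth_on (ball 0 r) G" and r: "r > 0"
  shows "dirD (axis 2 1) (dirD (axis 1 1) G) 0 = dirD (axis 1 1) (dirD (axis 2 1) G) 0"
proof -
  obtain k where k: "smooth_on (ball 0 r) k"
    and Gk: "\<And>q. q \<in> ball 0 r \<Longrightarrow> G q = G (shrink2 0 q) + q$2 *\<^sub>R k q"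
    using Hadamard[OF G] by metis
  have s: "shrink2 0 q \<in> ball 0 r" if "q \<in> ball 0 r" for q
    using shrink2_in_ball[OF that] by simp
  have S: "shrink2 0 differentiable (at q)" "dirD w (shrink2 0) q = shrink2 0 w" for q w
    using bounded_linear_imp_has_derivative[OF bounded_linear_shrink2, of 0 "at q"]
      dirD_eq[of "shrink2 0" "shrink2 0" q w] by (auto intro: differentiableI)
  have v: "(\<lambda>q::real^2. q$2) differentiable (at q)" for q
    using bounded_linear_imp_differentiable[OF bounded_linear_vec_nth] .
  have D: "dirD w G q = dirD (shrink2 0 w) G (shrink2 0 q) + (q$2 *\<^sub>R dirD w k q + w$2 *\<^sub>R k q)"
    if q: "q \<in> ball 0 r" for q w
  proof -
    have Gs: "(\<lambda>q. G (shrink2 0 q)) differentiable (at q)"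
      using has_derivative_compose_dirD[OF S(1) smooth_on_differentiable[OF G s[OF q]]] by (rule differentiableI)
    have "dirD w G q = dirD w (\<lambda>q. G (shrink2 0 q) + q$2 *\<^sub>R k q) q"
      by (rule dirD_cong[OF open_ball q Gk])
    also have "\<dots> = dirD w (\<lambda>q. G (shrink2 0 q)) q + dirD w (\<lambda>q. q$2 *\<^sub>R k q) q"
      by (intro dirD_add Gs differentiable_scaleR v smooth_on_differentiable[OF k q])
    also have "dirD w (\<lambda>q. G (shrink2 0 q)) q = dirD (shrink2 0 w) G (shrink2 0 q)"
      using dirD_chain[OF S(1) smooth_on_differentiable[OF G s[OF q]]] by (simp add: S)
    also have "dirD w (\<lambda>q. q$2 *\<^sub>R k q) q = q$2 *\<^sub>R dirD w k q + w$2 *\<^sub>R k q"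
      by (simp add: dirD_scaleR[OF v smooth_on_differentiable[OF k q]] dirD_coordinate)
    finally show ?thesis .
  qed
  have e: "shrink2 0 (axis 1 1) = axis 1 1" "shrink2 0 (axis 2 1) = 0" "shrink2 0 0 = 0"
    by (simp_all add: vec_eq_iff forall_2 axis_def shrink2_def)
  have 0: "(0::real^2) \<in> ball 0 r" using r by simp
  have lin0: "dirD 0 F x = 0" if "F differentiable (at x)" for F :: "real^2 \<Rightarrow> 'b" and x
    using linear_0[OF dirD_linear[OF that]] .
  have k': "dirD w k differentiable (at 0)" for w
    using smooth_on_differentiable[OF smooth_on_dirD[OF k] 0] .
  have G1: "dirD (axis 1 1) G differentiable (at 0)"
    using smooth_on_differentiable[OF smooth_on_dirD[OF G] 0] .
  have "dirD (axis 2 1) (dirD (axis 1 1) G) 0 =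
      dirD (axis 2 1) (\<lambda>q. dirD (axis 1 1) G (shrink2 0 q) + q$2 *\<^sub>R dirD (axis 1 1) k q) 0"
    by (rule dirD_cong[OF open_ball 0]) (simp add: D e)
  also have "\<dots> = dirD (axis 2 1) (\<lambda>q. dirD (axis 1 1) G (shrink2 0 q)) 0 +
      dirD (axis 2 1) (\<lambda>q. q$2 *\<^sub>R dirD (axis 1 1) k q) 0"
    by (intro dirD_add differentiable_scaleR v k'
      differentiableI[OF has_derivative_compose_dirD[OF S(1)]]) (simp add: e G1)
  also have "dirD (axis 2 1) (\<lambda>q. dirD (axis 1 1) G (shrink2 0 q)) 0 = 0"
    by (subst dirD_chain[OF S(1)]) (simp_all add: e S G1 lin0)
  also have "dirD (axis 2 1) (\<lambda>q. q$2 *\<^sub>R dirD (axis 1 1) k q) 0 = dirD (axis 1 1) k 0"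
    by (simp add: dirD_scaleR[OF v k'] dirD_coordinate)
  finally have L: "dirD (axis 2 1) (dirD (axis 1 1) G) 0 = dirD (axis 1 1) k 0" by simp
  have "dirD (axis 1 1) (dirD (axis 2 1) G) 0 =
      dirD (axis 1 1) (\<lambda>q. q$2 *\<^sub>R dirD (axis 2 1) k q + k q) 0"
    using lin0[OF smooth_on_differentiable[OF G s]]
    by (intro dirD_cong[OF open_ball 0]) (simp add: D e)
  also have "\<dots> = dirD (axis 1 1) (\<lambda>q. q$2 *\<^sub>R dirD (axis 2 1) k q) 0 + dirD (axis 1 1) k 0"
    by (intro dirD_add differentiable_scaleR v k' smooth_on_differentiable[OF k 0])
  also have "dirD (axis 1 1) (\<lambda>q. q$2 *\<^sub>R dirD (axis 2 1) k q) 0 = 0"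
    by (simp add: dirD_scaleR[OF v k'] dirD_coordinate axis_def)
  finally show ?thesis using L by simp
qed

text \<open>Reduction to the plane: restrict $F$ to the affine plane through $x$ spanned by $a$ and $b$.\<close>

lemma dirD_commute:
  fixes F :: "'a::euclidean_space \<Rightarrow> 'b::euclidean_space"
  assumes "open S" "smooth_on S F" "x \<in> S"
  shows "dirD a (dirD b F) x = dirD b (dirD a F) x"
proof -
  define A where "A q = q$1 *\<^sub>R a + q$2 *\<^sub>R b" for q :: "real^2"
  have A: "bounded_linear A"
    unfolding A_def by (intro bounded_linear_add bounded_linear_scaleR_left[THEN bounded_linear_compose]
        bounded_linear_vec_nth)
  have dA: "((\<lambda>q. x + A q) has_derivative A) (at q)" for q
    using bounded_linear_imp_has_derivative[OF A] by (auto intro!: derivative_eq_intros)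
  have "open ((\<lambda>q. x + A q) -` S)"
    using \<open>open S\<close> linear_continuous_on[OF A]
    by (intro open_vimage continuous_intros)
  moreover have "0 \<in> (\<lambda>q. x + A q) -` S"
    using \<open>x \<in> S\<close> by (simp add: A_def)
  ultimately obtain r where r: "r > 0" "ball 0 r \<subseteq> (\<lambda>q. x + A q) -` S"
    unfolding open_contains_ball by blast
  then have in_S: "x + A q \<in> S" if "q \<in> ball 0 r" for q using that by auto
  have smA: "smooth_on (ball 0 r) (\<lambda>q. x + A q)"
    by (intro smooth_intros smooth_on_bounded_linear[OF _ A] open_ball)
  have G: "smooth_on (ball 0 r) (\<lambda>q. F (x + A q))"
    using smooth_on_compose[OF open_ball \<open>open S\<close> in_S smA assms(2)] .
  have dF: "dirD w (\<lambda>q. H (x + A q)) q = dirD (A w) H (x + A q)"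
    if "smooth_on S H" "q \<in> ball 0 r" for H :: "'a \<Rightarrow> 'b" and q w
    using dirD_chain[OF differentiableI[OF dA] smooth_on_differentiable[OF that(1) in_S[OF that(2)]]]
    by (simp add: dirD_eq[OF dA])
  have 2: "dirD v (dirD w (\<lambda>q. F (x + A q))) 0 = dirD (A v) (dirD (A w) F) x" for v w
  proof -
    have 0: "(0::real^2) \<in> ball 0 r" using r by simp
    have "dirD v (dirD w (\<lambda>q. F (x + A q))) 0 = dirD v (\<lambda>q. dirD (A w) F (x + A q)) 0"
      by (rule dirD_cong[OF open_ball 0]) (rule dF[OF assms(2)])
    also have "\<dots> = dirD (A v) (dirD (A w) F) (x + A 0)"
      by (rule dF[OF smooth_on_dirD[OF assms(2)] 0])
    finally show ?thesis by (simp add: A_def)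
  qed
  have "A (axis 1 1) = a" "A (axis 2 1) = b"
    by (simp_all add: A_def axis_def)
  then show ?thesis
    using dirD_commute_plane[OF G r(1)] unfolding 2 by simp
qed

section \<open>Division by $v$ and continuation to the axis\<close>

text \<open>Identities that are obtained after multiplication by $v$ hold off the $u$-axis; this extends
  them to the axis.\<close>

lemma zero_on_axis:
  fixes F :: "real^2 \<Rightarrow> 'b::real_normed_vector"
  assumes cont: "continuous_on (ball 0 r) F"
    and off: "\<And>q. q \<in> ball 0 r \<Longrightarrow> q$2 \<noteq> 0 \<Longrightarrow> F q = 0"
    and q: "q \<in> ball 0 r"
  shows "F q = 0"
proof (cases "q$2 = 0")
  case True
  have c: "isCont F q"
    using cont q by (simp add: continuous_on_eq_continuous_at)
  have lim: "((\<lambda>t. q + t *\<^sub>R axis 2 1) \<longlongrightarrow> q) (at (0::real))"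
    by (auto intro!: tendsto_eq_intros)
  have "((\<lambda>t. F (q + t *\<^sub>R axis 2 1)) \<longlongrightarrow> F q) (at (0::real))"
    using isCont_tendsto_compose[OF c lim] .
  moreover have "\<forall>\<^sub>F t in at (0::real). q + t *\<^sub>R axis 2 1 \<in> ball 0 r"
    using lim q by (intro topological_tendstoD) auto
  then have "\<forall>\<^sub>F t in at (0::real). F (q + t *\<^sub>R axis 2 1) = 0"
    using eventually_neq_at_within[of 0 0 UNIV]
    by eventually_elim (auto intro!: off simp: True)
  then have "((\<lambda>t. F (q + t *\<^sub>R axis 2 1)) \<longlongrightarrow> 0) (at (0::real))"
    by (rule tendsto_eventually)
  ultimately show ?thesis
    using tendsto_unique trivial_limit_at by blast
qed (use assms in auto)

lemma smooth_germ_ball: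
  assumes "smooth_germ F"
  obtains r where "r > 0" "smooth_on (ball 0 r) F"
  using assms smooth_on_subset unfolding smooth_germ_def open_contains_ball by metis

lemma Hadamard_zero:
  fixes F :: "real^2 \<Rightarrow> 'b::euclidean_space"
  assumes "smooth_on (ball 0 r) F" "\<And>q. q \<in> ball 0 r \<Longrightarrow> q$2 = 0 \<Longrightarrow> F q = 0"
  obtains k where "smooth_on (ball 0 r) k" "\<And>q. q \<in> ball 0 r \<Longrightarrow> F q = q$2 *\<^sub>R k q"
proof -
  obtain k where k: "smooth_on (ball 0 r) k"
    and Fk: "\<And>q. q \<in> ball 0 r \<Longrightarrow> F q = F (shrink2 0 q) + q$2 *\<^sub>R k q"
    using Hadamard[OF assms(1)] by metis
  have "F (shrink2 0 q) = 0" if "q \<in> ball 0 r" for q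
    using assms(2)[OF shrink2_in_ball[OF that]] by simp
  then show thesis using that[OF k] Fk by simp
qed

text \<open>Hadamard's lemma provides a candidate for the choice in the definition of \<open>div_v\<close>.\<close>

lemma div_v_spec:
  assumes "smooth_on (ball 0 r) g" "r > 0" "\<And>q. q \<in> ball 0 r \<Longrightarrow> q$2 = 0 \<Longrightarrow> g q = 0"
  shows "smooth_germ (div_v g)" "\<forall>\<^sub>F q in nhds 0. g q = q$2 *\<^sub>R div_v g q"
proof -
  obtain k where k: "smooth_on (ball 0 r) k" "\<And>q. q \<in> ball 0 r \<Longrightarrow> g q = q$2 *\<^sub>R k q"
    using Hadamard_zero[OF assms(1,3)] by metis
  have "smooth_germ k" "\<forall>\<^sub>F q in nhds 0. g q = q$2 *\<^sub>R k q"
    unfolding smooth_germ_def eventually_nhds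
    using k \<open>r > 0\<close> by (auto intro!: exI[of _ "ball 0 r"])
  then have "\<exists>k. smooth_germ k \<and> (\<forall>\<^sub>F q in nhds 0. g q = q$2 *\<^sub>R k q)" by blast
  from someI_ex[OF this] show "smooth_germ (div_v g)" "\<forall>\<^sub>F q in nhds 0. g q = q$2 *\<^sub>R div_v g q"
    unfolding div_v_def by blast+
qed

section \<open>Gradients\<close>

definition grad :: "('a::euclidean_space \<Rightarrow> real) \<Rightarrow> 'a \<Rightarrow> 'a" where
  "grad F x = (\<Sum>b\<in>Basis. dirD b F x *\<^sub>R b)"

lemma inner_grad: "F differentiable (at x) \<Longrightarrow> grad F x \<bullet> w = dirD w F x"
  by (subst dirD_Basis) (simp_all add: grad_def inner_sum_left inner_commute[of w] mult.commute)

lemma smooth_on_grad: "open S \<Longrightarrow> smooth_on S F \<Longrightarrow> smooth_on S (grad F)"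
  unfolding grad_def[abs_def] by (intro smooth_on_sum smooth_intros finite_Basis)

text \<open>The Hessian enters as the derivative of the gradient, evaluated against vectors.\<close>

lemma inner_dirD_grad:
  assumes "open S" "smooth_on S F" "x \<in> S"
  shows "a \<bullet> dirD b (grad F) x = dirD b (dirD a F) x"
proof -
  have g: "grad F differentiable (at x)"
    using smooth_on_differentiable[OF smooth_on_grad[OF assms(1,2)] assms(3)] .
  have "a \<bullet> dirD b (grad F) x = dirD b (\<lambda>x. a \<bullet> grad F x) x"
    by (subst dirD_inner) (simp_all add: g)
  also have "\<dots> = dirD b (dirD a F) x"
    using assms by (intro dirD_cong[OF assms(1,3)])
      (metis inner_grad inner_commute smooth_on_differentiable)
  finally show ?thesis .
qed

lemma hessian_symmetric:
  assumes "open S" "smooth_on S F" "x \<in> S"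
  shows "a \<bullet> dirD b (grad F) x = b \<bullet> dirD a (grad F) x"
  using inner_dirD_grad[OF assms] dirD_commute[OF assms] by metis

section \<open>Frontals in adapted coordinates\<close>

text \<open>Both $n$ and $w$ are multiples of $a \times b$.\<close>

lemma orthogonal_pair_parallel:
  fixes a b n w :: "real^3"
  assumes "cross3 a b \<noteq> 0" "n \<bullet> a = 0" "n \<bullet> b = 0" "w \<bullet> a = 0" "w \<bullet> b = 0" "n \<bullet> n = 1"
  shows "w = (w \<bullet> n) *\<^sub>R n"
proof -
  let ?c = "cross3 a b"
  have parallel: "(?c \<bullet> ?c) *\<^sub>R v = (?c \<bullet> v) *\<^sub>R ?c" if "v \<bullet> a = 0" "v \<bullet> b = 0" for v
    using Lagrange[of ?c ?c v] Lagrange[of v a b] that cross_skew[of ?c v] by simp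
  define s t where "s = (?c \<bullet> w) / (?c \<bullet> ?c)" and "t = (?c \<bullet> n) / (?c \<bullet> ?c)"
  have w: "w = s *\<^sub>R ?c" and n: "n = t *\<^sub>R ?c"
    using parallel[of w] parallel[of n] assms(1-5)
    by (simp_all add: s_def t_def vector_fraction_eq_iff eq_vector_fraction_iff)
  have "t * t * (?c \<bullet> ?c) = 1"
    using assms(6) by (subst (asm) (1 2) n) simp
  then have s: "s * (t * t * (?c \<bullet> ?c)) = s" by simp
  have "w \<bullet> n = s * t * (?c \<bullet> ?c)"
    by (subst w, subst n) simp
  then have "(w \<bullet> n) *\<^sub>R n = (s * t * (?c \<bullet> ?c)) *\<^sub>R (t *\<^sub>R ?c)"
    by (simp only: n[symmetric])
  also have "\<dots> = s *\<^sub>R ?c"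
    using s by (simp add: algebra_simps)
  finally show ?thesis using w by simp
qed

lemma orthonormal_expansion:
  fixes a b n w :: "real^3"
  assumes "a \<bullet> a = 1" "b \<bullet> b = 1" "n \<bullet> n = 1" "a \<bullet> b = 0" "a \<bullet> n = 0" "b \<bullet> n = 0"
  shows "w = (w \<bullet> a) *\<^sub>R a + (w \<bullet> b) *\<^sub>R b + (w \<bullet> n) *\<^sub>R n"
proof -
  have "cross3 a b \<noteq> 0"
    using norm_cross[of a b] assms by (auto simp: power2_norm_eq_inner)
  let ?w = "w - (w \<bullet> a) *\<^sub>R a - (w \<bullet> b) *\<^sub>R b"
  have "?w = (?w \<bullet> n) *\<^sub>R n"
    by (rule orthogonal_pair_parallel[OF \<open>cross3 a b \<noteq> 0\<close>])
      (use assms in \<open>simp_all add: inner_diff_left inner_diff_right inner_commute\<close>)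
  then show ?thesis
    using assms by (simp add: inner_diff_left algebra_simps inner_commute)
qed

text \<open>The ball is so small that $g_u$ and $h$ stay independent; they are orthonormal at the origin,
  the point at which curvatures are computed.\<close>

locale adapted_frontal =
  fixes g n h :: "real^2 \<Rightarrow> real^3" and r :: real
  assumes r_pos: "r > 0"
    and smooth_g: "smooth_on (ball 0 r) g"
    and smooth_n: "smooth_on (ball 0 r) n"
    and smooth_h: "smooth_on (ball 0 r) h"
    and unit: "q \<in> ball 0 r \<Longrightarrow> n q \<bullet> n q = 1"
    and normal: "q \<in> ball 0 r \<Longrightarrow> dirD w g q \<bullet> n q = 0"
    and dv_g: "q \<in> ball 0 r \<Longrightarrow> dv g q = q$2 *\<^sub>R h q"
    and independent: "q \<in> ball 0 r \<Longrightarrow> cross3 (du g q) (h q) \<noteq> 0"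
    and frame_0: "du g 0 \<bullet> du g 0 = 1" "h 0 \<bullet> h 0 = 1" "du g 0 \<bullet> h 0 = 0"
begin

declare r_pos [simp]

lemma zero_in [simp]: "0 \<in> ball 0 r"
  using r_pos by simp

lemmas diff_g [simp] = differentiable_intros[OF smooth_g]
lemmas diff_n [simp] = differentiable_intros[OF smooth_n]
lemmas diff_h [simp] = differentiable_intros[OF smooth_h]

lemma dirD_cong_ball:
  assumes "q \<in> ball 0 r" "\<And>q. q \<in> ball 0 r \<Longrightarrow> H q = K q"
  shows "dirD w H q = dirD w K q"
  by (rule dirD_cong[OF open_ball assms])

text \<open>From $g_v \cdot n = v\, h \cdot n$, extended to the axis by continuity.\<close>

lemma h_normal: assumes "q \<in> ball 0 r" shows "h q \<bullet> n q = 0"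
proof -
  have "continuous_on (ball 0 r) (\<lambda>q. h q \<bullet> n q)"
    by (intro smooth_on_continuous_on smooth_intros smooth_h smooth_n open_ball)
  then show ?thesis
  proof (rule zero_on_axis[OF _ _ assms])
    fix q :: "real^2" assume "q \<in> ball 0 r" "q$2 \<noteq> 0"
    then show "h q \<bullet> n q = 0" using normal[of q "axis 2 1"] by (simp add: dv_g)
  qed
qed

lemma dirD_n_orthogonal: assumes "q \<in> ball 0 r" shows "n q \<bullet> dirD w n q = 0"
proof -
  have "dirD w (\<lambda>q. n q \<bullet> n q) q = dirD w (\<lambda>q. 1) q"
    using unit by (intro dirD_cong[OF open_ball assms])
  then show ?thesis using assms by (simp add: dirD_inner inner_commute)
qed

lemma dv_du_g: "q \<in> ball 0 r \<Longrightarrow> dv (du g) q = q$2 *\<^sub>R du h q"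
  using dirD_cong_ball[OF _ dv_g, where q = q and w = "axis 1 1"]
  by (simp add: dirD_commute[OF open_ball smooth_g] dirD_rules)

text \<open>Off the axis, orthogonality to the image of $dg$ is orthogonality to $g_u$ and $h$; the latter
  condition persists on the axis and determines the direction.\<close>

lemma orthogonal_multiple:
  assumes N: "smooth_on (ball 0 r) N" "\<And>q w. q \<in> ball 0 r \<Longrightarrow> N q \<bullet> dirD w g q = 0"
    and q: "q \<in> ball 0 r"
  shows "N q = (N q \<bullet> n q) *\<^sub>R n q"
proof -
  have "N q \<bullet> h q = 0"
  proof (rule zero_on_axis[OF _ _ q])
    show "continuous_on (ball 0 r) (\<lambda>q. N q \<bullet> h q)"
      by (intro smooth_on_continuous_on smooth_intros smooth_h N open_ball)
    fix q :: "real^2" assume "q \<in> ball 0 r" "q$2 \<noteq> 0"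
    then show "N q \<bullet> h q = 0" using N(2)[of q "axis 2 1"] by (simp add: dv_g)
  qed
  then show ?thesis
    using N(2)[OF q] normal[OF q] h_normal[OF q] unit[OF q]
    by (intro orthogonal_pair_parallel[OF independent[OF q]]) (simp_all add: inner_commute)
qed

lemma expansion_0: "w = (w \<bullet> du g 0) *\<^sub>R du g 0 + (w \<bullet> h 0) *\<^sub>R h 0 + (w \<bullet> n 0) *\<^sub>R n 0"
  using orthonormal_expansion[OF frame_0(1,2) unit[OF zero_in] frame_0(3)]
    normal[OF zero_in] h_normal[OF zero_in] by blast

end

section \<open>The conormal of a cuspidal edge\<close>

text \<open>The part of the equivalence with $(u, v^2, v^5)$ that the argument uses: $T_2$ and $T_3$ are the
  second and third component of the diffeomorphism of the target, $y$ is the second component of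
  the diffeomorphism of the source. The latter vanishes on the singular set, the $u$-axis, which
  makes it divisible by $v$.\<close>

locale adapted_cuspidal = adapted_frontal +
  fixes T\<^sub>2 T\<^sub>3 :: "real^3 \<Rightarrow> real" and V :: "(real^3) set" and y z :: "real^2 \<Rightarrow> real"
  assumes open_V: "open V"
    and g_in_V: "q \<in> ball 0 r \<Longrightarrow> g q \<in> V"
    and smooth_T2: "smooth_on V T\<^sub>2"
    and smooth_T3: "smooth_on V T\<^sub>3"
    and smooth_y: "smooth_on (ball 0 r) y"
    and smooth_z: "smooth_on (ball 0 r) z"
    and y_eq: "q \<in> ball 0 r \<Longrightarrow> y q = q$2 * z q"
    and z_0: "z 0 \<noteq> 0"
    and T2_g: "q \<in> ball 0 r \<Longrightarrow> T\<^sub>2 (g q) = y q ^ 2"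
    and T3_g: "q \<in> ball 0 r \<Longrightarrow> T\<^sub>3 (g q) = y q ^ 5"
    and grad_T3: "q \<in> ball 0 r \<Longrightarrow> grad T\<^sub>3 (g q) \<noteq> 0"
begin

lemmas diff_y [simp] = differentiable_intros[OF smooth_y]
lemmas diff_z [simp] = differentiable_intros[OF smooth_z]

text \<open>The normal $(0, -\frac{5}{2} y^3, 1)$ of $(x, y^2, y^5)$, pulled back by the diffeomorphism of the
  target.\<close>

definition conormal :: "real^2 \<Rightarrow> real^3" where
  "conormal q = grad T\<^sub>3 (g q) - (5/2 * y q ^ 3) *\<^sub>R grad T\<^sub>2 (g q)"

lemma smooth_grad_g:
  assumes "smooth_on V T" shows "smooth_on (ball 0 r) (\<lambda>q. grad T (g q))"
  using smooth_on_compose[OF open_ball open_V g_in_V smooth_g smooth_on_grad[OF open_V assms]] .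

lemma smooth_conormal: "smooth_on (ball 0 r) conormal"
  unfolding conormal_def[abs_def]
  by (intro smooth_intros smooth_grad_g smooth_T2 smooth_T3 smooth_y open_ball)

lemma dirD_T_g:
  assumes "smooth_on V T" "q \<in> ball 0 r"
  shows "grad T (g q) \<bullet> dirD w g q = dirD w (\<lambda>q. T (g q)) q"
  using assms g_in_V
  by (simp add: inner_grad[OF smooth_on_differentiable[OF assms(1)]]
      dirD_chain[OF diff_g(1) smooth_on_differentiable[OF assms(1)]])

lemma grad_T2_g: "q \<in> ball 0 r \<Longrightarrow> grad T\<^sub>2 (g q) \<bullet> dirD w g q = 2 * y q * dirD w y q"
  using dirD_cong_ball[OF _ T2_g, where q = q and w = w]
  by (simp add: dirD_T_g[OF smooth_T2] dirD_power)

lemma grad_T3_g: "q \<in> ball 0 r \<Longrightarrow> grad T\<^sub>3 (g q) \<bullet> dirD w g q = 5 * y q ^ 4 * dirD w y q"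
  using dirD_cong_ball[OF _ T3_g, where q = q and w = w]
  by (simp add: dirD_T_g[OF smooth_T3] dirD_power)

text \<open>The chain rule gives $5 y^4 \, dy - \frac{5}{2} y^3 \cdot 2 y\, dy = 0$.\<close>

lemma conormal_orthogonal: "q \<in> ball 0 r \<Longrightarrow> conormal q \<bullet> dirD w g q = 0"
  by (simp add: conormal_def inner_diff_left grad_T2_g grad_T3_g power_numeral_reduce)

definition conormal_factor :: "real^2 \<Rightarrow> real" where
  "conormal_factor q = conormal q \<bullet> n q"

lemma smooth_conormal_factor: "smooth_on (ball 0 r) conormal_factor"
  unfolding conormal_factor_def[abs_def] by (intro smooth_intros smooth_conormal smooth_n open_ball)

lemmas diff_conormal_factor [simp] = differentiable_intros[OF smooth_conormal_factor]

lemma conormal_eq: "q \<in> ball 0 r \<Longrightarrow> conormal q = conormal_factor q *\<^sub>R n q"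
  unfolding conormal_factor_def
  using orthogonal_multiple[OF smooth_conormal conormal_orthogonal] .

lemma conormal_factor_nonzero: "q \<in> ball 0 r \<Longrightarrow> q$2 = 0 \<Longrightarrow> conormal_factor q \<noteq> 0"
  using conormal_eq[of q] grad_T3[of q] y_eq[of q] by (auto simp: conormal_def)

lemma dirD_grad_g:
  assumes "smooth_on V T" "q \<in> ball 0 r"
  shows "dirD w (\<lambda>q. grad T (g q)) q = dirD (dirD w g q) (grad T) (g q)"
  using dirD_chain[OF diff_g(1) smooth_on_differentiable[OF smooth_on_grad[OF open_V assms(1)] g_in_V]]
    assms(2) by blast

lemma dirD_conormal:
  assumes "q \<in> ball 0 r"
  shows "dirD w conormal q = dirD (dirD w g q) (grad T\<^sub>3) (g q) -
    ((5/2 * y q ^ 3) *\<^sub>R dirD (dirD w g q) (grad T\<^sub>2) (g q) +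
     (15/2 * y q ^ 2 * dirD w y q) *\<^sub>R grad T\<^sub>2 (g q))"
proof -
  have "(\<lambda>q. y q ^ 3) differentiable (at q)"
    using assms by (intro differentiable_power diff_y)
  then have y3: "(\<lambda>q. 5/2 * y q ^ 3) differentiable (at q)"
      "dirD w (\<lambda>q. 5/2 * y q ^ 3) q = 15/2 * y q ^ 2 * dirD w y q"
    using dirD_mult[of "\<lambda>q. 5/2" q "\<lambda>q. y q ^ 3" w] dirD_power[OF diff_y(1)[OF assms], of w 3]
    by (simp_all add: differentiable_mult)
  have gr: "(\<lambda>q. grad T\<^sub>2 (g q)) differentiable (at q)" "(\<lambda>q. grad T\<^sub>3 (g q)) differentiable (at q)"
    using smooth_on_differentiable[OF smooth_grad_g assms] smooth_T2 smooth_T3 by blast+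
  have "dirD w conormal q = dirD w (\<lambda>q. grad T\<^sub>3 (g q)) q - dirD w (\<lambda>q. (5/2 * y q ^ 3) *\<^sub>R grad T\<^sub>2 (g q)) q"
    unfolding conormal_def[abs_def] using gr y3(1)
    by (intro dirD_diff differentiable_scaleR)
  also have "dirD w (\<lambda>q. (5/2 * y q ^ 3) *\<^sub>R grad T\<^sub>2 (g q)) q =
      (5/2 * y q ^ 3) *\<^sub>R dirD (dirD w g q) (grad T\<^sub>2) (g q) +
     (15/2 * y q ^ 2 * dirD w y q) *\<^sub>R grad T\<^sub>2 (g q)"
    using dirD_scaleR[OF y3(1) gr(1), of w] by (simp only: y3(2) dirD_grad_g[OF smooth_T2 assms])
  finally show ?thesis by (simp only: dirD_grad_g[OF smooth_T3 assms])
qed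

lemma dirD_conormal_factor:
  "q \<in> ball 0 r \<Longrightarrow> dirD w conormal q = conormal_factor q *\<^sub>R dirD w n q + dirD w conormal_factor q *\<^sub>R n q"
  using dirD_cong_ball[OF _ conormal_eq, where q = q and w = w] by (simp add: dirD_scaleR)

text \<open>On the axis $y = 0$ and $g_v = 0$, so the conormal is stationary in the direction $v$. As $n$ is
  orthogonal to $n_v$, its two summands $c_v n$ and $c\, n_v$ vanish separately, where $c$ is the
  factor of the conormal.\<close>

lemma axis_stationary:
  assumes "q \<in> ball 0 r" "q$2 = 0"
  shows "dv conormal_factor q = 0" "dv n q = 0"
proof -
  have gr: "grad T differentiable (at (g q))" if "smooth_on V T" for T
    using smooth_on_differentiable[OF smooth_on_grad[OF open_V that] g_in_V[OF assms(1)]] .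
  have 0: "conormal_factor q *\<^sub>R dv n q + dv conormal_factor q *\<^sub>R n q = 0"
    using dirD_conormal[OF assms(1), of "axis 2 1"] dirD_conormal_factor[OF assms(1), of "axis 2 1"]
      dirD_zero[OF gr[OF smooth_T2]] dirD_zero[OF gr[OF smooth_T3]] assms
    by (simp add: dv_g y_eq)
  from arg_cong[OF this, of "\<lambda>w. n q \<bullet> w"] show "dv conormal_factor q = 0"
    using dirD_n_orthogonal[OF assms(1)] unit[OF assms(1)] by (simp add: inner_add_right)
  with 0 show "dv n q = 0" using conormal_factor_nonzero[OF assms] by simp
qed

end

section \<open>Fundamental forms and principal curvatures at the origin\<close>

locale adapted_pure_frontal = adapted_frontal +
  fixes m :: "real^2 \<Rightarrow> real^3"
  assumes smooth_m: "smooth_on (ball 0 r) m"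
    and dv_n: "q \<in> ball 0 r \<Longrightarrow> dv n q = q$2 *\<^sub>R m q"
begin

lemmas diff_m [simp] = differentiable_intros[OF smooth_m]

text \<open>The coefficients with tilde, for $h$ and $m$ given as parts of the locale.\<close>

definition "E q = du g q \<bullet> du g q"
definition "F q = du g q \<bullet> h q"
definition "G q = h q \<bullet> h q"
definition "L q = - (du g q \<bullet> du n q)"
definition "M q = - (h q \<bullet> du n q)"
definition "N q = - (h q \<bullet> m q)"

lemmas form_defs = E_def F_def G_def L_def M_def N_def

lemma smooth_forms:
  "smooth_on (ball 0 r) E" "smooth_on (ball 0 r) F" "smooth_on (ball 0 r) G"
  "smooth_on (ball 0 r) L" "smooth_on (ball 0 r) M" "smooth_on (ball 0 r) N"
  unfolding form_defs[abs_def]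
  by (intro smooth_intros smooth_g smooth_h smooth_n smooth_m open_ball)+

lemmas diff_forms [simp] = smooth_forms[THEN differentiable_intros(1)]

text \<open>Both sides are equal to $-h_u \cdot n$: differentiate $g_u \cdot n = 0$ along $v$ and cancel the
  factor $v$, and differentiate $h \cdot n = 0$ along $u$.\<close>

lemma mixed_symmetric: assumes "q \<in> ball 0 r" shows "du g q \<bullet> m q = h q \<bullet> du n q"
proof -
  have "continuous_on (ball 0 r) (\<lambda>q. du g q \<bullet> m q - h q \<bullet> du n q)"
    by (intro smooth_on_continuous_on smooth_intros smooth_g smooth_h smooth_n smooth_m open_ball)
  then have "du g q \<bullet> m q - h q \<bullet> du n q = 0"
  proof (rule zero_on_axis[OF _ _ assms])
    fix q :: "real^2" assume q: "q \<in> ball 0 r" "q$2 \<noteq> 0"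
    have "dv (\<lambda>q. du g q \<bullet> n q) q = dv (\<lambda>q. 0) q"
      using normal by (intro dirD_cong[OF open_ball q(1)])
    then have "q$2 * (du g q \<bullet> m q + du h q \<bullet> n q) = 0"
      using q(1) by (simp add: dirD_inner dv_n dv_du_g algebra_simps)
    moreover have "du (\<lambda>q. h q \<bullet> n q) q = du (\<lambda>q. 0) q"
      using h_normal by (intro dirD_cong[OF open_ball q(1)])
    then have "h q \<bullet> du n q + du h q \<bullet> n q = 0"
      using q(1) by (simp add: dirD_inner)
    ultimately show "du g q \<bullet> m q - h q \<bullet> du n q = 0"
      using q(2) by simp
  qed
  then show ?thesis by simp
qed

lemma du_n_0: "du n 0 = - L 0 *\<^sub>R du g 0 - M 0 *\<^sub>R h 0"
  using expansion_0[of "du n 0"] dirD_n_orthogonal[OF zero_in, of "axis 1 1"]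
  by (simp add: L_def M_def inner_commute)

lemma dv_du_n: "q \<in> ball 0 r \<Longrightarrow> dv (du n) q = q$2 *\<^sub>R du m q"
  using dirD_cong_ball[OF _ dv_n, where q = q and w = "axis 1 1"]
  by (simp add: dirD_commute[OF open_ball smooth_n] dirD_rules)

text \<open>If $g_{vvv} = l\, g_{vv}$ at the origin, this is
  $\frac{1}{24}\, n \cdot (3 g_{vvvvv} - 10\, l\, g_{vvvv})$, the expression whose non-vanishing
  distinguishes $5/2$-cuspidal edges from more degenerate ones. The term with $g_u$
  takes account of coordinates in which $g_{vvv}$ has a component along the edge.\<close>

definition secondary_curvature :: real where
  "secondary_curvature = dv N 0 - 2 * M 0 * (dv h 0 \<bullet> du g 0) - 2 * N 0 * (dv h 0 \<bullet> h 0)"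

lemma forms_0: "E 0 = 1" "F 0 = 0" "G 0 = 1"
  using frame_0 by (simp_all add: form_defs)

lemma dv_forms_0:
  "dv E 0 = 0" "dv F 0 = dv h 0 \<bullet> du g 0" "dv G 0 = 2 * (dv h 0 \<bullet> h 0)" "dv L 0 = 0"
  "dv M 0 = L 0 * (dv h 0 \<bullet> du g 0) + M 0 * (dv h 0 \<bullet> h 0)"
proof -
  have neg: "dv (\<lambda>q. - f q) 0 = - dv f 0" if "f differentiable (at 0)" for f :: "real^2 \<Rightarrow> real"
    using dirD_diff[of "\<lambda>q. 0" 0 f] that by simp
  note z = dv_du_g[OF zero_in] dv_du_n[OF zero_in]
  show "dv E 0 = 0"
    unfolding E_def[abs_def]
    using dirD_inner[OF diff_g(2)[OF zero_in] diff_g(2)[OF zero_in]] by (simp add: z)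
  show "dv F 0 = dv h 0 \<bullet> du g 0"
    unfolding F_def[abs_def] by (subst dirD_inner) (simp_all add: z inner_commute)
  show "dv G 0 = 2 * (dv h 0 \<bullet> h 0)"
    unfolding G_def[abs_def] by (subst dirD_inner) (simp_all add: inner_commute)
  show "dv L 0 = 0"
    unfolding L_def[abs_def] by (simp add: neg dirD_inner z)
  have "dv M 0 = - (dv h 0 \<bullet> du n 0)"
    unfolding M_def[abs_def] by (simp add: neg dirD_inner z)
  then show "dv M 0 = L 0 * (dv h 0 \<bullet> du g 0) + M 0 * (dv h 0 \<bullet> h 0)"
    by (simp add: du_n_0 inner_diff_right)
qed

text \<open>Differentiate the equation of the principal curvatures along $v$. The terms on the right that
  contain $\kappa$ combine to a multiple of the equation at the origin, so that $\kappa$ only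
  remains in the factor $\tilde L - \kappa$.\<close>

lemma dv_principal_curvature:
  assumes k: "k differentiable (at 0)"
    and eq: "\<And>q. q \<in> ball 0 r \<Longrightarrow> (L q - k q * E q) * (N q - k q * G q) = (M q - k q * F q)\<^sup>2"
  shows "dv k 0 * (N 0 + L 0 - 2 * k 0) = (L 0 - k 0) * secondary_curvature"
proof -
  have d: "dv (\<lambda>q. H q - k q * K q) 0 = dv H 0 - (k 0 * dv K 0 + dv k 0 * K 0)"
    "(\<lambda>q. H q - k q * K q) differentiable (at 0)"
    if "H differentiable (at 0)" "K differentiable (at 0)" for H K :: "real^2 \<Rightarrow> real"
    using that k by (simp_all add: dirD_diff dirD_mult)
  have "dv (\<lambda>q. (L q - k q * E q) * (N q - k q * G q)) 0 = dv (\<lambda>q. (M q - k q * F q) * (M q - k q * F q)) 0"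
    by (rule dirD_cong[OF open_ball zero_in]) (simp add: eq power2_eq_square)
  moreover have "dv (\<lambda>q. (L q - k q * E q) * (N q - k q * G q)) 0 =
      (L 0 - k 0) * (dv N 0 - (k 0 * (2 * (dv h 0 \<bullet> h 0)) + dv k 0)) - dv k 0 * (N 0 - k 0)"
    by (subst dirD_mult) (simp_all only: d diff_forms zero_in, simp_all add: forms_0 dv_forms_0(1-4))
  moreover have "dv (\<lambda>q. (M q - k q * F q) * (M q - k q * F q)) 0 =
      2 * M 0 * (dv M 0 - k 0 * (dv h 0 \<bullet> du g 0))"
    by (subst dirD_mult) (simp_all only: d diff_forms zero_in, simp_all add: forms_0 dv_forms_0(1-4))
  ultimately have "(L 0 - k 0) * (dv N 0 - (k 0 * (2 * (dv h 0 \<bullet> h 0)) + dv k 0)) - dv k 0 * (N 0 - k 0) =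
      2 * M 0 * (dv M 0 - k 0 * (dv h 0 \<bullet> du g 0))"
    by simp
  moreover have "(L 0 - k 0) * (N 0 - k 0) = M 0 * M 0"
    using eq[OF zero_in] by (simp add: forms_0 power2_eq_square)
  ultimately show ?thesis
    unfolding secondary_curvature_def dv_forms_0(5) by algebra
qed

end

section \<open>The Gaussian curvature of a focal surface\<close>

context adapted_pure_frontal
begin

text \<open>The second fundamental form of $C$ at the origin has a vanishing $vv$-coefficient, so the
  $uu$-coefficient is irrelevant and the curvature is determined by $C_{uv}$. The normal is
  represented by the unnormalised cross product $T$ of $C_u$ and $C_v$, whose squared length is
  the determinant $W$ of the first fundamental form.\<close>

lemma focal_gaussian_curvature:
  assumes smooth_rho: "smooth_on (ball 0 r) \<rho>"
    and rho: "\<rho> 0 = 1 / k" and "k \<noteq> 0"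
    and principal: "(L 0 - k) * (N 0 - k) = (M 0)\<^sup>2"
    and M: "M 0 \<noteq> 0"
    and rho_v: "dv \<rho> 0 \<noteq> 0"
  shows "gaussian_curvature (\<lambda>q. g q + \<rho> q *\<^sub>R n q) 0 =
    - ((M 0)\<^sup>2 * k ^ 4 / ((M 0)\<^sup>2 + (L 0 - k)\<^sup>2)\<^sup>2)"
proof -
  let ?C = "\<lambda>q. g q + \<rho> q *\<^sub>R n q"
  note dr = differentiable_intros[OF smooth_rho]
  have du_C: "du ?C q = du g q + (\<rho> q *\<^sub>R du n q + du \<rho> q *\<^sub>R n q)" if "q \<in> ball 0 r" for q
    using that dr by (simp add: dirD_add dirD_scaleR)
  have dv_C: "dv ?C q = q$2 *\<^sub>R (h q + \<rho> q *\<^sub>R m q) + dv \<rho> q *\<^sub>R n q" if "q \<in> ball 0 r" for q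
    using that dr by (simp add: dirD_add dirD_scaleR dv_g dv_n algebra_simps)
  have dvdu_C: "dv (du ?C) 0 = dv \<rho> 0 *\<^sub>R du n 0 + dv (du \<rho>) 0 *\<^sub>R n 0"
  proof -
    have "dv (du ?C) 0 = dv (\<lambda>q. du g q + (\<rho> q *\<^sub>R du n q + du \<rho> q *\<^sub>R n q)) 0"
      by (rule dirD_cong_ball[OF zero_in du_C])
    also have "\<dots> = dv \<rho> 0 *\<^sub>R du n 0 + dv (du \<rho>) 0 *\<^sub>R n 0"
      using dr[OF zero_in] diff_g[OF zero_in] diff_n[OF zero_in]
      by (simp add: dirD_add dirD_scaleR dv_n[OF zero_in] dv_du_g[OF zero_in] dv_du_n[OF zero_in])
    finally show ?thesis .
  qed
  have dvdv_C: "dv (dv ?C) 0 = h 0 + \<rho> 0 *\<^sub>R m 0 + dv (dv \<rho>) 0 *\<^sub>R n 0"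
  proof -
    have "dv (dv ?C) 0 = dv (\<lambda>q. q$2 *\<^sub>R (h q + \<rho> q *\<^sub>R m q) + dv \<rho> q *\<^sub>R n q) 0"
      by (rule dirD_cong_ball[OF zero_in dv_C])
    also have "\<dots> = h 0 + \<rho> 0 *\<^sub>R m 0 + dv (dv \<rho>) 0 *\<^sub>R n 0"
      using dr[OF zero_in] diff_h[OF zero_in] diff_n[OF zero_in] diff_m[OF zero_in]
      by (simp add: dirD_add dirD_scaleR dirD_coordinate dv_n[OF zero_in])
    finally show ?thesis .
  qed
  define a b c where "a = du g 0" and "b = h 0" and "c = n 0"
  define \<alpha> \<beta> \<sigma> where "\<alpha> = 1 - \<rho> 0 * L 0" and "\<beta> = - \<rho> 0 * M 0" and "\<sigma> = dv \<rho> 0"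
  have abc: "a \<bullet> a = 1" "b \<bullet> b = 1" "c \<bullet> c = 1" "a \<bullet> b = 0" "b \<bullet> a = 0"
      "a \<bullet> c = 0" "c \<bullet> a = 0" "b \<bullet> c = 0" "c \<bullet> b = 0"
    using frame_0 unit[OF zero_in] normal[OF zero_in] h_normal[OF zero_in]
    by (simp_all add: a_def b_def c_def inner_commute)
  have nu: "du n 0 = - L 0 *\<^sub>R a - M 0 *\<^sub>R b"
    using du_n_0 by (simp add: a_def b_def)
  have m0: "a \<bullet> m 0 = - M 0" "b \<bullet> m 0 = - N 0"
    using mixed_symmetric[OF zero_in] by (simp_all add: a_def b_def M_def N_def)
  define A B where "A = pd 1 ?C 0" and "B = pd 2 ?C 0"
  have A: "A = \<alpha> *\<^sub>R a + \<beta> *\<^sub>R b + du \<rho> 0 *\<^sub>R c"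
    using du_C[OF zero_in] by (simp add: A_def pd_eq_dirD nu \<alpha>_def \<beta>_def algebra_simps flip: a_def b_def c_def)
  have B: "B = \<sigma> *\<^sub>R c"
    using dv_C[OF zero_in] by (simp add: B_def pd_eq_dirD \<sigma>_def c_def)
  define T where "T = cross3 A B"
  \<comment> \<open>The orientation of the frame is not prescribed, so its sign $\delta = \pm 1$ is carried along; only its square enters the result.\<close>
  define \<delta> where "\<delta> = a \<bullet> cross3 b c"
  have T: "T = \<sigma> *\<^sub>R (\<alpha> *\<^sub>R cross3 a c + \<beta> *\<^sub>R cross3 b c)"
    by (simp add: T_def A B cross_add_left cross_mult_left cross_mult_right algebra_simps)
  have triple: "a \<bullet> cross3 a c = 0" "b \<bullet> cross3 b c = 0" "b \<bullet> cross3 a c = - \<delta>"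
    "a \<bullet> cross3 b c = \<delta>" "c \<bullet> cross3 a c = 0" "c \<bullet> cross3 b c = 0"
    using cross_triple[of a c b] cross_skew[of c b]
    by (auto simp: dot_cross_self \<delta>_def inner_commute)
  have delta: "\<delta>\<^sup>2 = 1"
  proof -
    have "cross3 b c = \<delta> *\<^sub>R a"
      using orthonormal_expansion[of a b c "cross3 b c"] abc triple
      by (simp add: inner_commute)
    then show ?thesis
      using dot_cross[of b c b c] abc by (simp add: power2_eq_square)
  qed
  define W where "W = (\<alpha>\<^sup>2 + \<beta>\<^sup>2) * \<sigma>\<^sup>2"
  have W: "A \<bullet> A * (B \<bullet> B) - (A \<bullet> B)\<^sup>2 = W"
    by (simp add: A B W_def inner_add_left inner_add_right abc power2_eq_square algebra_simps)
  have TW: "T \<bullet> T = W"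
    using dot_cross[of A B A B] W by (simp add: T_def power2_eq_square inner_commute)
  have "\<rho> 0 \<noteq> 0" using rho \<open>k \<noteq> 0\<close> by simp
  then have "\<beta> \<noteq> 0" using M by (simp add: \<beta>_def)
  then have Wpos: "W > 0"
    using rho_v by (simp add: W_def \<sigma>_def add_nonneg_pos)
  have mixed: "pd 2 (pd 1 ?C) 0 \<bullet> T = \<sigma>\<^sup>2 * \<delta> * M 0"
    by (simp add: pd_eq_dirD dvdu_C nu T inner_add_left inner_add_right inner_diff_left triple
        \<alpha>_def \<beta>_def power2_eq_square algebra_simps flip: c_def \<sigma>_def)
  \<comment> \<open>Up to a factor this inner product is the characteristic equation of the curvature $k$.\<close>
  have "pd 2 (pd 2 ?C) 0 \<bullet> T = 0"
  proof -
    let ?w = "b + \<rho> 0 *\<^sub>R m 0 + dv (dv \<rho>) 0 *\<^sub>R c"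
    have cc: "m 0 = (- M 0) *\<^sub>R a + (- N 0) *\<^sub>R b + (m 0 \<bullet> c) *\<^sub>R c"
      using orthonormal_expansion[of a b c "m 0"] abc m0 by (simp add: inner_commute)
    have mT: "m 0 \<bullet> T = \<sigma> * \<delta> * (\<alpha> * N 0 - \<beta> * M 0)"
      by (subst cc) (simp add: T inner_add_left inner_add_right triple algebra_simps)
    have bT: "b \<bullet> T = - \<sigma> * \<delta> * \<alpha>" "c \<bullet> T = 0"
      by (simp_all add: T inner_add_right triple)
    have "?w \<bullet> T = \<sigma> * \<delta> * (\<rho> 0 * (\<alpha> * N 0 - \<beta> * M 0) - \<alpha>)"
      by (simp add: inner_add_left mT bT algebra_simps)
    also have "\<rho> 0 * (\<alpha> * N 0 - \<beta> * M 0) - \<alpha> = ((M 0)\<^sup>2 - (L 0 - k) * (N 0 - k)) / k\<^sup>2"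
      using \<open>k \<noteq> 0\<close> by (simp add: \<alpha>_def \<beta>_def rho field_simps power2_eq_square)
    finally show ?thesis
      using principal by (simp add: pd_eq_dirD dvdv_C b_def c_def)
  qed
  then have "gaussian_curvature ?C 0 = - (pd 2 (pd 1 ?C) 0 \<bullet> T)\<^sup>2 / (T \<bullet> T) / W"
    unfolding gaussian_curvature_def surface_normal_def Let_def
      A_def[symmetric] B_def[symmetric] T_def[symmetric] W
    by (simp add: power_mult_distrib power_divide power2_norm_eq_inner)
  also have "\<dots> = - (M 0)\<^sup>2 / (\<alpha>\<^sup>2 + \<beta>\<^sup>2)\<^sup>2"
  proof -
    have cancel: "- (S\<^sup>2 * m) / (P * S) / (P * S) = - m / P\<^sup>2" if "S \<noteq> 0" for S P m :: real
      using that by (simp add: field_simps power2_eq_square)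
    have square: "(\<sigma>\<^sup>2 * \<delta> * M 0)\<^sup>2 = (\<sigma>\<^sup>2)\<^sup>2 * (M 0)\<^sup>2"
      using delta by (simp add: power_mult_distrib)
    have "\<sigma>\<^sup>2 \<noteq> 0" using rho_v by (simp add: \<sigma>_def)
    then show ?thesis
      unfolding TW mixed W_def square by (rule cancel)
  qed
  also have "\<alpha>\<^sup>2 + \<beta>\<^sup>2 = ((M 0)\<^sup>2 + (L 0 - k)\<^sup>2) / k\<^sup>2"
    using \<open>k \<noteq> 0\<close> by (simp add: \<alpha>_def \<beta>_def rho field_simps power2_eq_square)
  finally show ?thesis
    by (simp add: power_divide flip: power_mult)
qed

end

section \<open>The secondary curvature of a cuspidal edge\<close>

locale adapted_cuspidal_edge =
  adapted_cuspidal g n h r T\<^sub>2 T\<^sub>3 V y z + adapted_pure_frontal g n h r m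
  for g n h r T\<^sub>2 T\<^sub>3 V y z m
begin

text \<open>The Hessian of $T_3$ at $g$, applied to $h$.\<close>

definition hess :: "real^2 \<Rightarrow> real^3" where
  "hess q = dirD (h q) (grad T\<^sub>3) (g q)"

lemma grad_diff:
  assumes "smooth_on V T" "q \<in> ball 0 r"
  shows "grad T differentiable (at (g q))" "dirD b (grad T) differentiable (at (g q))"
  using differentiable_intros[OF smooth_on_grad[OF open_V assms(1)] g_in_V[OF assms(2)]] by blast+

text \<open>Here both the direction and the base point depend on $q$; the expansion over a basis separates the
  two dependencies.\<close>

lemma dirD_grad_sum:
  assumes "smooth_on V T" "q \<in> ball 0 r"
  shows "dirD (h q) (grad T) (g q) = (\<Sum>b\<in>Basis. (h q \<bullet> b) *\<^sub>R dirD b (grad T) (g q))"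
  by (rule dirD_Basis[OF grad_diff(1)[OF assms]])

lemma smooth_hess:
  assumes "smooth_on V T" shows "smooth_on (ball 0 r) (\<lambda>q. dirD (h q) (grad T) (g q))"
proof -
  have "smooth_on (ball 0 r) (\<lambda>q. dirD b (grad T) (g q))" for b
    using smooth_on_compose[OF open_ball open_V g_in_V smooth_g
        smooth_on_dirD[OF smooth_on_grad[OF open_V assms]]] .
  then have "smooth_on (ball 0 r) (\<lambda>q. \<Sum>b\<in>Basis. (h q \<bullet> b) *\<^sub>R dirD b (grad T) (g q))"
    by (intro smooth_on_sum smooth_intros smooth_h open_ball finite_Basis)
  from smooth_on_cong[OF open_ball dirD_grad_sum[OF assms, symmetric] this] show ?thesis .
qed

text \<open>The base point contributes nothing, because $g_v = 0$ at the origin.\<close>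

lemma dv_hess: "dv hess 0 = dirD (dv h 0) (grad T\<^sub>3) (g 0)"
proof -
  note gd = grad_diff[OF smooth_T3 zero_in]
  have "dv (\<lambda>q. dirD b (grad T\<^sub>3) (g q)) 0 = 0" "(\<lambda>q. dirD b (grad T\<^sub>3) (g q)) differentiable (at 0)" for b
    using dirD_chain[OF diff_g(1)[OF zero_in] gd(2)[of b], of "axis 2 1"] dirD_zero[OF gd(2)]
      differentiableI[OF has_derivative_compose_dirD[OF diff_g(1)[OF zero_in] gd(2)[of b]]]
    by (simp_all add: dv_g[OF zero_in])
  then have diff: "(\<lambda>q. (h q \<bullet> b) *\<^sub>R dirD b (grad T\<^sub>3) (g q)) differentiable (at 0)"
    and dv_term: "dv (\<lambda>q. (h q \<bullet> b) *\<^sub>R dirD b (grad T\<^sub>3) (g q)) 0 = (dv h 0 \<bullet> b) *\<^sub>R dirD b (grad T\<^sub>3) (g 0)" for b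
    using diff_h[OF zero_in]
    by (simp_all add: differentiable_scaleR differentiable_inner dirD_scaleR dirD_inner)
  have "dv hess 0 = dv (\<lambda>q. \<Sum>b\<in>Basis. (h q \<bullet> b) *\<^sub>R dirD b (grad T\<^sub>3) (g q)) 0"
    unfolding hess_def[abs_def] by (rule dirD_cong_ball[OF zero_in dirD_grad_sum[OF smooth_T3]])
  also have "\<dots> = (\<Sum>b\<in>Basis. dv (\<lambda>q. (h q \<bullet> b) *\<^sub>R dirD b (grad T\<^sub>3) (g q)) 0)"
    by (rule dirD_eq[OF has_derivative_sum[OF has_derivative_dirD[OF diff]]])
  also have "\<dots> = dirD (dv h 0) (grad T\<^sub>3) (g 0)"
    unfolding dv_term by (rule dirD_Basis[OF gd(1), symmetric])
  finally show ?thesis .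
qed

text \<open>Compute $v\, h \cdot (\mbox{conormal})_v$ in two ways. On the one hand the conormal is $c\,n$, on the
  other hand it is given by gradients, where $v\, \nabla T_2 \cdot h = 2 y y_v$ by the chain
  rule. Everything is divisible by $v^2$ since $y = v z$.\<close>

lemma N_via_hessian:
  assumes "q \<in> ball 0 r"
  shows "- (conormal_factor q * N q) = h q \<bullet> hess q - (15 * q$2 * z q ^ 3 * (dv y q)\<^sup>2 +
    5/2 * q$2 ^ 3 * z q ^ 3 * (h q \<bullet> dirD (h q) (grad T\<^sub>2) (g q)))"
proof -
  let ?R = "\<lambda>q. - (conormal_factor q * N q) - (h q \<bullet> hess q - (15 * q$2 * z q ^ 3 * (dv y q)\<^sup>2 +
    5/2 * q$2 ^ 3 * z q ^ 3 * (h q \<bullet> dirD (h q) (grad T\<^sub>2) (g q))))"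
  have "smooth_on (ball 0 r) hess"
    unfolding hess_def[abs_def] by (rule smooth_hess[OF smooth_T3])
  then have "continuous_on (ball 0 r) ?R"
    by (intro smooth_on_continuous_on smooth_intros open_ball smooth_conormal_factor smooth_forms smooth_h
        smooth_z smooth_y smooth_hess smooth_T2)
  then have "?R q = 0"
  proof (rule zero_on_axis[OF _ _ assms])
    fix q :: "real^2" assume q: "q \<in> ball 0 r" "q$2 \<noteq> 0"
    let ?v = "q$2"
    have lin: "dirD (?v *\<^sub>R h q) (grad T) (g q) = ?v *\<^sub>R dirD (h q) (grad T) (g q)"
      if "smooth_on V T" for T
      using linear_cmul[OF dirD_linear[OF grad_diff(1)[OF that q(1)]]] .
    have T2h: "?v * (grad T\<^sub>2 (g q) \<bullet> h q) = 2 * y q * dv y q"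
      using grad_T2_g[OF q(1), of "axis 2 1"] by (simp add: dv_g[OF q(1)])
    have "- (conormal_factor q * ?v * N q) = h q \<bullet> dv conormal q"
      using dirD_conormal_factor[OF q(1), of "axis 2 1"] h_normal[OF q(1)]
      by (simp add: inner_add_right dv_n[OF q(1)] N_def)
    also have "\<dots> = ?v * (h q \<bullet> hess q) - (5/2 * y q ^ 3 * ?v * (h q \<bullet> dirD (h q) (grad T\<^sub>2) (g q)) +
        15/2 * y q ^ 2 * dv y q * (grad T\<^sub>2 (g q) \<bullet> h q))"
      unfolding dirD_conormal[OF q(1)] dv_g[OF q(1)] lin[OF smooth_T2] lin[OF smooth_T3]
      by (simp add: inner_diff_right inner_add_right hess_def inner_commute)
    finally have "?v * - (conormal_factor q * ?v * N q) = ?v * (?v * (h q \<bullet> hess q) -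
        (5/2 * y q ^ 3 * ?v * (h q \<bullet> dirD (h q) (grad T\<^sub>2) (g q)) +
        15/2 * y q ^ 2 * dv y q * (grad T\<^sub>2 (g q) \<bullet> h q)))"
      by (rule arg_cong)
    also have "\<dots> = ?v\<^sup>2 * (h q \<bullet> hess q) - (5/2 * y q ^ 3 * ?v\<^sup>2 * (h q \<bullet> dirD (h q) (grad T\<^sub>2) (g q)) +
        15/2 * y q ^ 2 * dv y q * (?v * (grad T\<^sub>2 (g q) \<bullet> h q)))"
      by (simp add: algebra_simps power2_eq_square)
    finally have "?v\<^sup>2 * ?R q = 0"
      unfolding T2h y_eq[OF q(1)] by (simp add: algebra_simps power2_eq_square power3_eq_cube)
    then show "?R q = 0" using q(2) by simp
  qed
  then show ?thesis by simp
qed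

text \<open>Differentiate the preceding formula along $v$ at the origin and expand $h_v$ in the frame. With
  the Hessian $B$ of $T_3$, one has $B(g_u, h) = -c \tilde M$ and $B(h, h) = -c \tilde N_1$, so
  the two Hessian terms $2 B(h, h_v)$ are the two correction terms in the definition of the secondary
  curvature; what remains comes from $15\, v z^3 y_v^2$.\<close>

lemma secondary_curvature_eq: "conormal_factor 0 * secondary_curvature = 15 * z 0 ^ 5"
proof -
  let ?S = "\<lambda>q. dirD (h q) (grad T\<^sub>2) (g q)"
  define R where "R q = 15 * z q ^ 3 * (dv y q)\<^sup>2 + 5/2 * q$2 ^ 2 * z q ^ 3 * (h q \<bullet> ?S q)" for q
  have sm_hess: "smooth_on (ball 0 r) hess"
    unfolding hess_def[abs_def] by (rule smooth_hess[OF smooth_T3])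
  have "smooth_on (ball 0 r) R"
    unfolding R_def[abs_def] by (intro smooth_intros open_ball smooth_h smooth_z smooth_y smooth_hess smooth_T2)
  then have dR: "R differentiable (at 0)"
    by (rule smooth_on_differentiable) simp
  have dhess: "hess differentiable (at 0)"
    using smooth_on_differentiable[OF sm_hess zero_in] .
  have dy: "dv y 0 = z 0"
  proof -
    have "dv y 0 = dv (\<lambda>q. q$2 * z q) 0"
      by (rule dirD_cong_ball[OF zero_in y_eq])
    then show ?thesis
      using diff_z[OF zero_in] by (simp add: dirD_mult dirD_coordinate)
  qed
  have "dv (\<lambda>q. conormal_factor q * N q) 0 = dv (\<lambda>q. q$2 * R q - h q \<bullet> hess q) 0"
    by (rule dirD_cong_ball[OF zero_in])
      (use N_via_hessian in \<open>simp add: R_def algebra_simps power3_eq_cube power2_eq_square\<close>)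
  also have "\<dots> = R 0 - (h 0 \<bullet> dv hess 0 + dv h 0 \<bullet> hess 0)"
    using dR dhess diff_h[OF zero_in]
    by (subst dirD_diff) (simp_all add: dirD_mult[OF differentiable_coordinate dR] dirD_inner dirD_coordinate
        differentiable_inner differentiable_mult)
  also have "R 0 = 15 * z 0 ^ 5" by (simp add: R_def dy power_numeral_reduce)
  also have "h 0 \<bullet> dv hess 0 = dv h 0 \<bullet> hess 0"
    unfolding dv_hess hess_def
    by (rule hessian_symmetric[OF open_V smooth_T3 g_in_V[OF zero_in]])
  also have "dv (\<lambda>q. conormal_factor q * N q) 0 = conormal_factor 0 * dv N 0"
    using axis_stationary(1)[OF zero_in] diff_conormal_factor[OF zero_in] diff_forms(6)[OF zero_in]
    by (simp add: dirD_mult)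
  finally have 1: "conormal_factor 0 * dv N 0 = 15 * z 0 ^ 5 - 2 * (dv h 0 \<bullet> hess 0)" by simp
  have hh: "h 0 \<bullet> hess 0 = - conormal_factor 0 * N 0"
    using N_via_hessian[OF zero_in] by simp
  have "du g 0 \<bullet> hess 0 = h 0 \<bullet> dirD (du g 0) (grad T\<^sub>3) (g 0)"
    unfolding hess_def by (rule hessian_symmetric[OF open_V smooth_T3 g_in_V[OF zero_in]])
  also have "dirD (du g 0) (grad T\<^sub>3) (g 0) = du conormal 0"
    using dirD_conormal[OF zero_in, of "axis 1 1"] y_eq[OF zero_in] by simp
  also have "h 0 \<bullet> du conormal 0 = - conormal_factor 0 * M 0"
    using dirD_conormal_factor[OF zero_in, of "axis 1 1"] h_normal[OF zero_in]
    by (simp add: inner_add_right M_def)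
  finally have gh: "du g 0 \<bullet> hess 0 = - conormal_factor 0 * M 0" .
  have "dv (\<lambda>q. h q \<bullet> n q) 0 = dv (\<lambda>q. 0) 0"
    using h_normal by (intro dirD_cong_ball[OF zero_in])
  then have hn: "dv h 0 \<bullet> n 0 = 0"
    using diff_h[OF zero_in] diff_n[OF zero_in] by (simp add: dirD_inner dv_n[OF zero_in])
  have "dv h 0 \<bullet> hess 0 = (dv h 0 \<bullet> du g 0) * (du g 0 \<bullet> hess 0) + (dv h 0 \<bullet> h 0) * (h 0 \<bullet> hess 0)"
    by (subst expansion_0[of "dv h 0"]) (simp add: inner_add_left hn)
  then show ?thesis
    using 1 unfolding secondary_curvature_def hh gh by (simp add: algebra_simps)
qed

lemma secondary_curvature_nonzero: "secondary_curvature \<noteq> 0"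
  using secondary_curvature_eq z_0 by auto

end

section \<open>Principal curvatures of the extended forms\<close>

context adapted_pure_frontal
begin

lemma forms_eq:
  assumes "h = div_v (pd 2 g)" "m = div_v (pd 2 n)"
  shows "tE g = E" "tF g = F" "tG g = G" "tL g n = L" "tM g n = M" "tN1 g n = N"
  unfolding fun_eq_iff tE_def tF_def tG_def tL_def tM_def tN1_def form_defs assms[symmetric]
  by (simp_all add: pd_eq_dirD)

lemma form_det_pos: "q \<in> ball 0 r \<Longrightarrow> E q * G q - (F q)\<^sup>2 > 0"
  using independent[of q] norm_cross[of "du g q" "h q", symmetric]
  by (simp add: form_defs power2_norm_eq_inner[symmetric])

lemma smooth_curvatures:
  assumes "h = div_v (pd 2 g)" "m = div_v (pd 2 n)"
  shows "smooth_on (ball 0 r) (frontal_K g n)" "smooth_on (ball 0 r) (frontal_H g n)"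
  unfolding frontal_K_def[abs_def] frontal_H_def[abs_def] forms_eq[OF assms]
  by (intro smooth_on_divide smooth_intros smooth_forms open_ball;
      use form_det_pos in force)+

text \<open>At the origin the discriminant is
  $\frac{1}{4} (\tilde L - \tilde N_1)^2 + \tilde M^2$.\<close>

lemma principal_curvatures_distinct:
  assumes "h = div_v (pd 2 g)" "m = div_v (pd 2 n)" "M 0 \<noteq> 0"
  shows "(frontal_H g n 0)\<^sup>2 - frontal_K g n 0 > 0"
proof -
  have "(frontal_H g n 0)\<^sup>2 - frontal_K g n 0 = ((L 0 - N 0) / 2)\<^sup>2 + (M 0)\<^sup>2"
    unfolding frontal_K_def frontal_H_def forms_eq[OF assms(1,2)] forms_0
    by (simp add: power2_eq_square field_simps)
  then show ?thesis
    using assms(3) by (simp add: add_nonneg_pos)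
qed

lemma principal_curvature_equation:
  assumes "h = div_v (pd 2 g)" "m = div_v (pd 2 n)" "q \<in> ball 0 r"
    and disc: "(frontal_H g n q)\<^sup>2 - frontal_K g n q \<ge> 0"
    and k: "k = principal_curvature j g n q"
  shows "(L q - k * E q) * (N q - k * G q) = (M q - k * F q)\<^sup>2"
proof -
  let ?D = "E q * G q - (F q)\<^sup>2"
  have D: "?D \<noteq> 0" using form_det_pos[OF assms(3)] by simp
  have "(k - frontal_H g n q)\<^sup>2 = (frontal_H g n q)\<^sup>2 - frontal_K g n q"
    using disc by (simp add: k principal_curvature_def)
  then have "?D * (k\<^sup>2 - 2 * frontal_H g n q * k + frontal_K g n q) = 0"
    by (simp add: power2_eq_square algebra_simps)
  moreover have "?D * frontal_K g n q = L q * N q - (M q)\<^sup>2"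
    "2 * ?D * frontal_H g n q = E q * N q - 2 * F q * M q + G q * L q"
    unfolding frontal_K_def frontal_H_def forms_eq[OF assms(1,2)] using D by simp_all
  ultimately show ?thesis by algebra
qed

end

text \<open>That $\kappa_v \neq 0$ follows since $\tilde L - \kappa$ and the secondary curvature are nonzero:
  the equation at the origin gives $(\tilde L - \kappa)(\tilde N_1 - \kappa) = \tilde M^2 \neq 0$.\<close>

lemma (in adapted_cuspidal_edge) focal_curvature_formula:
  fixes j :: nat
  assumes hm: "h = div_v (pd 2 g)" "m = div_v (pd 2 n)"
    and disc: "\<And>q. q \<in> ball 0 r \<Longrightarrow> (frontal_H g n q)\<^sup>2 - frontal_K g n q > 0"
    and nonzero: "\<And>q. q \<in> ball 0 r \<Longrightarrow> principal_curvature j g n q \<noteq> 0"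
    and M: "M 0 \<noteq> 0"
  shows "gaussian_curvature (focal_surface j g n) 0 =
    - ((M 0)\<^sup>2 * principal_curvature j g n 0 ^ 4 /
       ((M 0)\<^sup>2 + (L 0 - principal_curvature j g n 0)\<^sup>2)\<^sup>2)"
proof -
  define k where "k = principal_curvature j g n"
  have k: "smooth_on (ball 0 r) k"
  proof (cases "j = 1")
    case True
    show ?thesis
      unfolding k_def principal_curvature_def[abs_def] using True disc
      by (simp, intro smooth_on_sqrt smooth_intros smooth_curvatures[OF hm] open_ball) auto
  next
    case False
    show ?thesis
      unfolding k_def principal_curvature_def[abs_def] using False disc
      by (simp, intro smooth_on_sqrt smooth_intros smooth_curvatures[OF hm] open_ball) auto
  qed
  have eq: "(L q - k q * E q) * (N q - k q * G q) = (M q - k q * F q)\<^sup>2" if "q \<in> ball 0 r" for q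
    by (rule principal_curvature_equation[OF hm that less_imp_le[OF disc[OF that]]])
      (simp add: k_def)
  have eq0: "(L 0 - k 0) * (N 0 - k 0) = (M 0)\<^sup>2"
    using eq[OF zero_in] by (simp add: forms_0)
  have dk: "k differentiable (at 0)"
    using smooth_on_differentiable[OF k zero_in] .
  have "dv k 0 \<noteq> 0"
    using dv_principal_curvature[OF dk eq] secondary_curvature_nonzero eq0 M by auto
  have k0: "k q \<noteq> 0" if "q \<in> ball 0 r" for q
    using nonzero[OF that] by (simp add: k_def)
  have rho: "smooth_on (ball 0 r) (\<lambda>q. 1 / k q)"
    by (intro smooth_on_divide smooth_intros open_ball k k0)
  have "dv (\<lambda>q. k q * (1 / k q)) 0 = dv (\<lambda>q. 1) 0"
    by (rule dirD_cong_ball[OF zero_in]) (simp add: k0)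
  then have "k 0 * dv (\<lambda>q. 1 / k q) 0 + dv k 0 / k 0 = 0"
    using dirD_mult[OF dk smooth_on_differentiable[OF rho zero_in]] by simp
  then have "dv (\<lambda>q. 1 / k q) 0 \<noteq> 0"
    using \<open>dv k 0 \<noteq> 0\<close> k0[OF zero_in] by auto
  from focal_gaussian_curvature[OF rho refl k0[OF zero_in] eq0 M this]
  show ?thesis by (simp add: focal_surface_def[abs_def] k_def)
qed

section \<open>Germs\<close>

text \<open>Properties of germs are collected as properties of all sufficiently small balls, so that finitely
  many of them can be satisfied on one ball.\<close>

lemma small_balls:
  fixes P :: "'a::real_normed_vector \<Rightarrow> bool"
  assumes "\<forall>\<^sub>F q in nhds 0. P q"
  shows "\<forall>\<^sub>F r in at_right (0::real). \<forall>q\<in>ball 0 r. P q"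
proof -
  obtain e where "e > 0" "\<And>q. dist q 0 < e \<Longrightarrow> P q"
    using assms unfolding eventually_nhds_metric by blast
  then show ?thesis
    unfolding eventually_at_right_field by (intro exI[of _ e]) auto
qed

lemma smooth_germ_small_balls:
  assumes "smooth_germ F"
  shows "\<forall>\<^sub>F r in at_right (0::real). smooth_on (ball 0 r) F"
proof -
  obtain e where "e > 0" "smooth_on (ball 0 e) F"
    using smooth_germ_ball[OF assms] .
  then show ?thesis
    unfolding eventually_at_right_field
    by (intro exI[of _ e]) (auto intro: smooth_on_subset subset_ball)
qed

lemma smooth_germI: "r > 0 \<Longrightarrow> smooth_on (ball 0 r) F \<Longrightarrow> smooth_germ F"
  unfolding smooth_germ_def by (intro exI[of _ "ball 0 r"]) auto

lemma smooth_germ_isCont: "smooth_germ F \<Longrightarrow> isCont F 0"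
  unfolding smooth_germ_def
  using smooth_on_differentiable differentiable_imp_continuous_within by blast

lemma smooth_germ_eventually_pos:
  fixes F :: "'a::euclidean_space \<Rightarrow> real"
  assumes "smooth_germ F" "F 0 > 0"
  shows "\<forall>\<^sub>F q in nhds 0. F q > 0"
  using smooth_germ_isCont[OF assms(1)] assms(2)
  unfolding isCont_def tendsto_at_iff_tendsto_nhds by (rule order_tendstoD(1))

lemma smooth_germ_eventually_in:
  assumes "smooth_germ F" "open V" "F 0 \<in> V"
  shows "\<forall>\<^sub>F q in nhds 0. F q \<in> V"
  using smooth_germ_isCont[OF assms(1)] assms(2,3)
  unfolding isCont_def tendsto_at_iff_tendsto_nhds by (rule topological_tendstoD)

text \<open>Differentiating $\psi \circ \phi = \mathrm{id}$ shows that the differential is injective.\<close>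

lemma diffeo_germ_data:
  assumes "diffeo_germ \<phi>"
  obtains U where "open U" "0 \<in> U" "\<phi> 0 = 0" "smooth_on U \<phi>"
    "\<And>x w. x \<in> U \<Longrightarrow> dirD w \<phi> x = 0 \<Longrightarrow> w = 0"
proof -
  obtain U V \<psi> where U: "open U" "open V" "0 \<in> U" "homeomorphism U V \<phi> \<psi>" "smooth_on U \<phi>"
    "smooth_on V \<psi>" and "\<phi> 0 = 0"
    using assms unfolding diffeo_germ_def by blast
  have "w = 0" if x: "x \<in> U" and w: "dirD w \<phi> x = 0" for x w
  proof -
    have \<phi>x: "\<phi> x \<in> V" using U(4) x by (auto simp: homeomorphism_def)
    have "w = dirD w (\<lambda>x. x) x"
      by (simp add: dirD_def)
    also have "\<dots> = dirD w (\<lambda>x. \<psi> (\<phi> x)) x"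
      using U(4) by (intro dirD_cong[OF U(1) x]) (simp add: homeomorphism_def)
    also have "\<dots> = dirD 0 \<psi> (\<phi> x)"
      using dirD_chain[OF smooth_on_differentiable[OF U(5) x] smooth_on_differentiable[OF U(6) \<phi>x]]
      by (simp add: w)
    also have "\<dots> = 0"
      using linear_0[OF dirD_linear[OF smooth_on_differentiable[OF U(6) \<phi>x]]] .
    finally show ?thesis .
  qed
  with U \<open>\<phi> 0 = 0\<close> show thesis using that by blast
qed

lemma diffeo_germ_eventually:
  assumes "diffeo_germ \<phi>" "\<forall>\<^sub>F q in nhds 0. P q"
  shows "\<forall>\<^sub>F q in nhds 0. P (\<phi> q)"
proof -
  obtain U where "open U" "0 \<in> U" "\<phi> 0 = 0" "smooth_on U \<phi>"
    using diffeo_germ_data[OF assms(1)] .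
  then have "isCont \<phi> 0"
    using smooth_germ_isCont unfolding smooth_germ_def by blast
  then have "filterlim \<phi> (nhds 0) (nhds 0)"
    using \<open>\<phi> 0 = 0\<close> tendsto_at_iff_tendsto_nhds[of \<phi> 0] by (simp add: isCont_def)
  with assms(2) show ?thesis unfolding filterlim_iff by blast
qed

lemma smooth_germ_compose:
  assumes "smooth_germ F" "smooth_germ G" "G 0 = 0"
  shows "smooth_germ (F \<circ> G)"
proof -
  obtain S T where S: "open S" "0 \<in> S" "smooth_on S F" and T: "open T" "0 \<in> T" "smooth_on T G"
    using assms(1,2) unfolding smooth_germ_def by blast
  define W where "W = T \<inter> G -` S"
  have "open W"
    unfolding W_def using continuous_on_open_vimage[OF T(1)] smooth_on_continuous_on[OF T(3)] S(1)
    by (metis Int_commute)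
  moreover have "0 \<in> W" using S T assms(3) by (simp add: W_def)
  moreover have "smooth_on W (F \<circ> G)"
    unfolding o_def
    by (rule smooth_on_compose[OF \<open>open W\<close> S(1) _ smooth_on_subset[OF T(3)] S(3)]) (auto simp: W_def)
  ultimately show ?thesis unfolding smooth_germ_def by blast
qed

lemma diffeo_germ_smooth: "diffeo_germ \<phi> \<Longrightarrow> smooth_germ \<phi>"
  unfolding diffeo_germ_def smooth_germ_def by blast

text \<open>An injective endomorphism of $\mathbb{R}^n$ is onto, so no coordinate of the differential can
  vanish identically.\<close>

lemma grad_component_nonzero:
  fixes \<tau> :: "real^'n \<Rightarrow> real^'n"
  assumes "smooth_on U \<tau>" "x \<in> U" "\<And>w. dirD w \<tau> x = 0 \<Longrightarrow> w = 0"
  shows "grad (\<lambda>x. \<tau> x $ i) x \<noteq> 0"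
proof
  assume 0: "grad (\<lambda>x. \<tau> x $ i) x = 0"
  have d: "\<tau> differentiable (at x)" using smooth_on_differentiable[OF assms(1,2)] .
  have lin: "linear (\<lambda>w. dirD w \<tau> x)" using dirD_linear[OF d] .
  then have "inj (\<lambda>w. dirD w \<tau> x)"
    using assms(3) by (simp add: linear_injective_0)
  then obtain w where w: "dirD w \<tau> x = axis i 1"
    using linear_injective_imp_surjective[OF lin] by (metis surjD)
  have "(\<lambda>x. \<tau> x $ i) differentiable (at x)"
    using bounded_linear.has_derivative[OF bounded_linear_vec_nth has_derivative_dirD[OF d]]
    by (rule differentiableI)
  from inner_grad[OF this, of w] have "dirD w \<tau> x $ i = 0"
    by (simp add: 0 dirD_nth[OF d])
  then show False by (simp add: w axis_def)
qed

section \<open>From the germ to adapted data\<close>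

text \<open>Shows that the singular set is where the second source coordinate $y$ of the normal form
  vanishes and that $y_v \neq 0$ there. On the $u$-axis $g_v = 0$, hence
  $(s_1, s_2^2, s_2^5)$ has vanishing derivative along $v$, where $s$ is the source
  diffeomorphism composed with the change to adapted coordinates. So $s_1$ is stationary, and
  $s_2$ is not, because $s$ is a local diffeomorphism; then $s_2 \, (s_2)_v = 0$ forces $s_2 = 0$.\<close>

lemma adapted_cuspidal_germ:
  fixes f \<nu> :: "real^2 \<Rightarrow> real^3" and \<phi> :: "real^2 \<Rightarrow> real^2"
  assumes frontal: "frontal_with_normal f \<nu>"
    and cusp: "cuspidal_edge_5_2 f"
    and \<phi>: "diffeo_germ \<phi>"
    and adapted: "adapted (f \<circ> \<phi>) (\<nu> \<circ> \<phi>)"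
  obtains T\<^sub>2 T\<^sub>3 V y z where "\<forall>\<^sub>F r in at_right 0.
    adapted_cuspidal (f \<circ> \<phi>) (\<nu> \<circ> \<phi>) (div_v (pd 2 (f \<circ> \<phi>))) r T\<^sub>2 T\<^sub>3 V y z"
proof -
  define g n h where "g = f \<circ> \<phi>" and "n = \<nu> \<circ> \<phi>" and "h = div_v (pd 2 (f \<circ> \<phi>))"
  obtain U\<phi> where U\<phi>: "open U\<phi>" "0 \<in> U\<phi>" "\<phi> 0 = 0" "smooth_on U\<phi> \<phi>"
    "\<And>x w. x \<in> U\<phi> \<Longrightarrow> dirD w \<phi> x = 0 \<Longrightarrow> w = 0"
    using diffeo_germ_data[OF \<phi>] by metis
  obtain \<sigma> \<tau> where \<sigma>: "diffeo_germ \<sigma>" and \<tau>: "diffeo_germ \<tau>"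
    and \<tau>f: "\<forall>\<^sub>F q in nhds 0. \<tau> (f q) = vector [\<sigma> q $ 1, (\<sigma> q $ 2)^2, (\<sigma> q $ 2)^5]"
    using cusp unfolding cuspidal_edge_5_2_def A_equivalent_def by blast
  obtain U\<sigma> where U\<sigma>: "open U\<sigma>" "0 \<in> U\<sigma>" "\<sigma> 0 = 0" "smooth_on U\<sigma> \<sigma>"
    "\<And>x w. x \<in> U\<sigma> \<Longrightarrow> dirD w \<sigma> x = 0 \<Longrightarrow> w = 0"
    using diffeo_germ_data[OF \<sigma>] by metis
  obtain V where V: "open V" "0 \<in> V" "\<tau> 0 = 0" "smooth_on V \<tau>"
    "\<And>x w. x \<in> V \<Longrightarrow> dirD w \<tau> x = 0 \<Longrightarrow> w = 0"
    using diffeo_germ_data[OF \<tau>] by metis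
  have f0: "f 0 = 0" and sf: "smooth_germ f" and s\<nu>: "smooth_germ \<nu>"
    and fr: "\<forall>\<^sub>F q in nhds 0. norm (\<nu> q) = 1 \<and> (\<forall>X. frechet_derivative f (at q) X \<bullet> \<nu> q = 0)"
    using frontal unfolding frontal_with_normal_def by blast+
  have s\<phi>: "smooth_germ \<phi>" and s\<sigma>: "smooth_germ \<sigma>"
    using diffeo_germ_smooth \<phi> \<sigma> by blast+
  have sg: "smooth_germ g" and sn: "smooth_germ n"
    unfolding g_def n_def using smooth_germ_compose sf s\<nu> s\<phi> U\<phi>(3) by blast+
  define s where "s = \<sigma> \<circ> \<phi>"
  have ss: "smooth_germ s"
    unfolding s_def using smooth_germ_compose s\<sigma> s\<phi> U\<phi>(3) by blast
  have g0: "g 0 = 0" using f0 U\<phi>(3) by (simp add: g_def)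
  obtain Uf where Uf: "open Uf" "0 \<in> Uf" "smooth_on Uf f"
    using sf unfolding smooth_germ_def by blast
  have ev_\<phi>: "\<forall>\<^sub>F q in nhds 0. q \<in> U\<phi> \<and> \<phi> q \<in> Uf \<and> \<phi> q \<in> U\<sigma>"
    using eventually_nhds_in_open[OF U\<phi>(1,2)]
      smooth_germ_eventually_in[OF s\<phi> Uf(1)] smooth_germ_eventually_in[OF s\<phi> U\<sigma>(1)] Uf U\<sigma> U\<phi>(3)
    by (auto intro: eventually_conj)
  have ev_V: "\<forall>\<^sub>F q in nhds 0. g q \<in> V"
    using smooth_germ_eventually_in[OF sg V(1)] V(2) g0 by simp
  have ev_normal: "\<forall>\<^sub>F q in nhds 0. n q \<bullet> n q = 1 \<and> (\<forall>w. dirD w g q \<bullet> n q = 0)"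
    using ev_\<phi> diffeo_germ_eventually[OF \<phi> fr]
  proof eventually_elim
    case (elim q)
    have "dirD w g q = dirD (dirD w \<phi> q) f (\<phi> q)" for w
      unfolding g_def o_def
      using elim by (intro dirD_chain smooth_on_differentiable[OF U\<phi>(4)] smooth_on_differentiable[OF Uf(3)]) auto
    then show ?case
      using elim by (simp add: n_def dirD_def flip: power2_norm_eq_inner)
  qed
  have ev_\<tau>: "\<forall>\<^sub>F q in nhds 0. \<tau> (g q) = vector [s q $ 1, (s q $ 2)^2, (s q $ 2)^5]"
    using diffeo_germ_eventually[OF \<phi> \<tau>f] by (simp add: g_def s_def)
  have ev_null: "\<forall>\<^sub>F q in nhds 0. q$2 = 0 \<longrightarrow> dv g q = 0"
    using adapted unfolding adapted_def g_def dirD_def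
    by (auto elim: eventually_elim2)
  have ev_axis: "\<forall>\<^sub>F q in nhds 0. q$2 = 0 \<longrightarrow> s q $ 2 = 0 \<and> dv s q $ 2 \<noteq> 0"
  proof -
    have ev: "\<forall>\<^sub>F q in nhds 0. \<forall>\<^sub>F p in nhds q. \<tau> (g p) = vector [s p $ 1, (s p $ 2)^2, (s p $ 2)^5]"
      using ev_\<tau> by (simp add: eventually_eventually)
    show ?thesis
      using ev ev_\<phi> ev_V ev_null
    proof eventually_elim
      case (elim q)
      show ?case
      proof
        assume "q$2 = 0"
        then have null: "dv g q = 0" using elim by blast
        have d: "\<phi> differentiable (at q)" "\<sigma> differentiable (at (\<phi> q))" "f differentiable (at (\<phi> q))"
          "\<tau> differentiable (at (g q))"
          using elim smooth_on_differentiable[OF U\<phi>(4)] smooth_on_differentiable[OF U\<sigma>(4)]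
            smooth_on_differentiable[OF Uf(3)] smooth_on_differentiable[OF V(4)] by blast+
        have dg: "g differentiable (at q)" and ds: "s differentiable (at q)"
          unfolding g_def s_def o_def using has_derivative_compose_dirD d by (blast intro: differentiableI)+
        have d\<tau>g: "(\<lambda>p. \<tau> (g p)) differentiable (at q)"
          using has_derivative_compose_dirD[OF dg d(4)] by (rule differentiableI)
        have zero: "dv (\<lambda>p. \<tau> (g p)) q = 0"
          using dirD_chain[OF dg d(4), of "axis 2 1"] linear_0[OF dirD_linear[OF d(4)]] by (simp add: null)
        have s_nth: "(\<lambda>p. s p $ i) differentiable (at q)" for i
          using bounded_linear.has_derivative[OF bounded_linear_vec_nth has_derivative_dirD[OF ds]]
          by (rule differentiableI)
        have "dv (\<lambda>p. s p $ 1) q = dv (\<lambda>p. \<tau> (g p) $ 1) q"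
          using elim(1) by (intro dirD_cong_nhds) (auto elim: eventually_mono)
        then have 1: "dv s q $ 1 = 0"
          using zero by (simp add: dirD_nth[OF ds] dirD_nth[OF d\<tau>g])
        have "dv (\<lambda>p. (s p $ 2)^2) q = dv (\<lambda>p. \<tau> (g p) $ 2) q"
          using elim(1) by (intro dirD_cong_nhds) (auto elim: eventually_mono)
        then have 2: "s q $ 2 * dv s q $ 2 = 0"
          using zero by (simp add: dirD_power[OF s_nth] dirD_nth[OF ds] dirD_nth[OF d\<tau>g])
        have "dv s q \<noteq> 0"
        proof
          assume "dv s q = 0"
          then have "dirD (dv \<phi> q) \<sigma> (\<phi> q) = 0"
            using dirD_chain[OF d(1,2), of "axis 2 1"] by (simp add: s_def o_def)
          then have "axis 2 1 = (0::real^2)"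
            using elim U\<sigma>(5) U\<phi>(5) by blast
          then show False using axis_simps(2) by (metis zero_index zero_neq_one)
        qed
        with 1 have "dv s q $ 2 \<noteq> 0" by (auto simp: vec_eq_iff forall_2)
        with 2 show "s q $ 2 = 0 \<and> dv s q $ 2 \<noteq> 0" by simp
      qed
    qed
  qed
  define y where "y q = s q $ 2" for q
  have "\<forall>\<^sub>F r in at_right (0::real). r > 0 \<and> smooth_on (ball 0 r) s \<and> smooth_on (ball 0 r) g \<and>
      (\<forall>q\<in>ball 0 r. q$2 = 0 \<longrightarrow> s q $ 2 = 0 \<and> dv s q $ 2 \<noteq> 0) \<and> (\<forall>q\<in>ball 0 r. q$2 = 0 \<longrightarrow> dv g q = 0)"
    using small_balls[OF ev_axis] small_balls[OF ev_null] smooth_germ_small_balls[OF ss]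
      smooth_germ_small_balls[OF sg] eventually_at_right_less[of "0::real"]
    by eventually_elim blast
  then obtain r where r: "r > 0" "smooth_on (ball 0 r) s" "smooth_on (ball 0 r) g"
    and axis: "\<And>q. q \<in> ball 0 r \<Longrightarrow> q$2 = 0 \<Longrightarrow> s q $ 2 = 0 \<and> dv s q $ 2 \<noteq> 0"
    and null: "\<And>q. q \<in> ball 0 r \<Longrightarrow> q$2 = 0 \<Longrightarrow> dv g q = 0"
    using eventually_happens'[OF trivial_limit_at_right_real] by blast
  have 0: "(0::real^2) \<in> ball 0 r" using r(1) by simp
  have sy: "smooth_on (ball 0 r) y"
    unfolding y_def[abs_def] by (intro smooth_intros open_ball r)
  obtain z where z: "smooth_on (ball 0 r) z" "\<And>q. q \<in> ball 0 r \<Longrightarrow> y q = q$2 * z q"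
  proof (rule Hadamard_zero[OF sy])
    show "y q = 0" if "q \<in> ball 0 r" "q$2 = 0" for q using axis[OF that] by (simp add: y_def)
  qed (use that in auto)
  have dy: "dv y 0 = z 0"
  proof -
    have "dv y 0 = dv (\<lambda>q. q$2 * z q) 0"
      by (rule dirD_cong[OF open_ball 0 z(2)])
    then show ?thesis
      using smooth_on_differentiable[OF z(1) 0] by (simp add: dirD_mult dirD_coordinate)
  qed
  have z0: "z 0 \<noteq> 0"
    using axis[OF 0] dy dirD_nth[OF smooth_on_differentiable[OF r(2) 0]] by (simp add: y_def[abs_def])
  have sh: "smooth_germ h" and ev_h: "\<forall>\<^sub>F q in nhds 0. dv g q = q$2 *\<^sub>R h q"
    using div_v_spec[OF smooth_on_dirD[OF r(3)] r(1) null]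
    by (simp_all add: h_def g_def pd_eq_dirD)
  obtain rh where rh: "rh > 0" "smooth_on (ball 0 rh) h"
    using smooth_germ_ball[OF sh] .
  have h0: "pd 2 (pd 2 g) 0 = h 0"
    using dirD_cong_nhds[OF ev_h, of "axis 2 1"] smooth_on_differentiable[OF rh(2)] rh(1)
    by (simp add: pd_eq_dirD dirD_scaleR dirD_coordinate)
  have "norm (pd 1 g 0) = 1 \<and> norm (pd 2 (pd 2 g) 0) = 1 \<and> pd 1 g 0 \<bullet> pd 2 (pd 2 g) 0 = 0"
    using adapted eventually_nhds_x_imp_x unfolding adapted_def g_def by fastforce
  then have frame: "du g 0 \<bullet> du g 0 = 1" "h 0 \<bullet> h 0 = 1" "du g 0 \<bullet> h 0 = 0"
    unfolding h0 by (simp_all add: pd_eq_dirD flip: power2_norm_eq_inner)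
  have ev_indep: "\<forall>\<^sub>F q in nhds 0. cross3 (du g q) (h q) \<noteq> 0"
  proof -
    define \<rho> where "\<rho> = min r rh"
    have sub: "ball (0::real^2) \<rho> \<subseteq> ball 0 r" "ball (0::real^2) \<rho> \<subseteq> ball 0 rh"
      by (auto simp: \<rho>_def)
    have "smooth_on (ball 0 \<rho>) (\<lambda>q. (du g q \<bullet> du g q) * (h q \<bullet> h q) - (du g q \<bullet> h q)\<^sup>2)"
      by (intro smooth_intros open_ball smooth_on_subset[OF r(3) sub(1)] smooth_on_subset[OF rh(2) sub(2)])
    then have "\<forall>\<^sub>F q in nhds 0. (du g q \<bullet> du g q) * (h q \<bullet> h q) - (du g q \<bullet> h q)\<^sup>2 > 0"
      using r(1) rh(1) frame by (intro smooth_germ_eventually_pos smooth_germI[of \<rho>]) (simp_all add: \<rho>_def)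
    then show ?thesis
    proof eventually_elim
      case (elim q)
      then show ?case
        using norm_cross[of "du g q" "h q"] by (auto simp: power2_norm_eq_inner)
    qed
  qed
  have smT: "smooth_on V (\<lambda>x. \<tau> x $ i)" for i
    using smooth_on_nth[OF V(1,4)] .
  have ev_T: "\<forall>\<^sub>F q in nhds 0. \<tau> (g q) $ 2 = y q ^ 2 \<and> \<tau> (g q) $ 3 = y q ^ 5"
    using ev_\<tau> by eventually_elim (simp add: y_def vector_def)
  have ev_grad: "\<forall>\<^sub>F q in nhds 0. grad (\<lambda>x. \<tau> x $ 3) (g q) \<noteq> 0"
    using ev_V by eventually_elim (rule grad_component_nonzero[OF V(4) _ V(5)])
  have sz: "smooth_germ z" and syg: "smooth_germ y"
    using smooth_germI r(1) z(1) sy by blast+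
  have ev_y: "\<forall>\<^sub>F q in nhds 0. y q = q$2 * z q"
    using eventually_nhds_in_open[OF open_ball 0] by eventually_elim (rule z(2))
  have "\<forall>\<^sub>F r in at_right 0. adapted_cuspidal g n h r (\<lambda>x. \<tau> x $ 2) (\<lambda>x. \<tau> x $ 3) V y z"
    using eventually_at_right_less[of "0::real"] smooth_germ_small_balls[OF sg]
      smooth_germ_small_balls[OF sn] smooth_germ_small_balls[OF sh] smooth_germ_small_balls[OF syg]
      smooth_germ_small_balls[OF sz] small_balls[OF ev_normal] small_balls[OF ev_h]
      small_balls[OF ev_indep] small_balls[OF ev_V] small_balls[OF ev_T] small_balls[OF ev_grad]
      small_balls[OF ev_y]
  proof eventually_elim
    case (elim r')
    show ?case
      by unfold_locales (use elim frame V(1) smT z0 in blast)+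
  qed
  then show thesis
    using that unfolding g_def n_def h_def by blast
qed

section \<open>The curvature of the focal surfaces\<close>

theorem theorem4p14:
  fixes f \<nu> :: "real^2 \<Rightarrow> real^3" and \<phi> :: "real^2 \<Rightarrow> real^2" and j :: nat
  assumes "frontal_with_normal f \<nu>"
    and "cuspidal_edge_5_2 f"
    and "diffeo_germ \<phi>"
    and "adapted (f \<circ> \<phi>) (\<nu> \<circ> \<phi>)"
    and "\<forall>i\<in>{1,2}. \<forall>\<^sub>F q in nhds 0. principal_curvature i (f \<circ> \<phi>) (\<nu> \<circ> \<phi>) q \<noteq> 0"
    and "cuspidal_torsion (f \<circ> \<phi>) (\<nu> \<circ> \<phi>) 0 \<noteq> 0"
    and "j \<in> {1,2}"
  shows "gaussian_curvature (focal_surface j (f \<circ> \<phi>) (\<nu> \<circ> \<phi>)) 0 =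
           - ((cuspidal_torsion (f \<circ> \<phi>) (\<nu> \<circ> \<phi>) 0)\<^sup>2
               * (principal_curvature j (f \<circ> \<phi>) (\<nu> \<circ> \<phi>) 0) ^ 4
             / ((cuspidal_torsion (f \<circ> \<phi>) (\<nu> \<circ> \<phi>) 0)\<^sup>2
                 + (limiting_normal_curvature (f \<circ> \<phi>) (\<nu> \<circ> \<phi>) 0
                     - principal_curvature j (f \<circ> \<phi>) (\<nu> \<circ> \<phi>) 0)\<^sup>2)\<^sup>2)
         \<and> gaussian_curvature (focal_surface j (f \<circ> \<phi>) (\<nu> \<circ> \<phi>)) 0 < 0"
proof -
  define g n where "g = f \<circ> \<phi>" and "n = \<nu> \<circ> \<phi>"
  define h m where "h = div_v (pd 2 g)" and "m = div_v (pd 2 n)"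
  obtain T\<^sub>2 T\<^sub>3 V y z where small: "\<forall>\<^sub>F r in at_right 0. adapted_cuspidal g n h r T\<^sub>2 T\<^sub>3 V y z"
    using adapted_cuspidal_germ[OF assms(1-4)] unfolding g_def n_def h_def by blast
  then obtain r where "adapted_cuspidal g n h r T\<^sub>2 T\<^sub>3 V y z"
    using eventually_happens'[OF trivial_limit_at_right_real] by blast
  then interpret cuspidal: adapted_cuspidal g n h r T\<^sub>2 T\<^sub>3 V y z .
  have sm: "smooth_germ m" and ev_m: "\<forall>\<^sub>F q in nhds 0. dv n q = q$2 *\<^sub>R m q"
    using div_v_spec[OF smooth_on_dirD[OF cuspidal.smooth_n] cuspidal.r_pos cuspidal.axis_stationary(2)]
    by (simp_all add: m_def pd_eq_dirD)
  have edge: "\<forall>\<^sub>F r in at_right 0. adapted_cuspidal_edge g n h r T\<^sub>2 T\<^sub>3 V y z m"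
    using small smooth_germ_small_balls[OF sm] small_balls[OF ev_m]
  proof eventually_elim
    case (elim r)
    then interpret adapted_cuspidal g n h r T\<^sub>2 T\<^sub>3 V y z by blast
    show ?case by unfold_locales (use elim in blast)+
  qed
  then obtain r1 where "adapted_cuspidal_edge g n h r1 T\<^sub>2 T\<^sub>3 V y z m"
    using eventually_happens'[OF trivial_limit_at_right_real] by blast
  then interpret e1: adapted_cuspidal_edge g n h r1 T\<^sub>2 T\<^sub>3 V y z m .
  have torsion: "cuspidal_torsion g n 0 = e1.M 0" and normal_curvature: "limiting_normal_curvature g n 0 = e1.L 0"
  proof -
    have "vector [0, 0] = (0::real^2)" by (simp add: vec_eq_iff forall_2)
    then show "cuspidal_torsion g n 0 = e1.M 0" "limiting_normal_curvature g n 0 = e1.L 0"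
      by (simp_all add: cuspidal_torsion_def limiting_normal_curvature_def e1.forms_eq[OF h_def m_def])
  qed
  have M: "e1.M 0 \<noteq> 0"
    using assms(6) torsion by (simp add: g_def n_def)
  \<comment> \<open>Away from umbilics the principal curvatures are smooth; a smaller ball keeps the discriminant positive.\<close>
  have "smooth_germ (\<lambda>q. (frontal_H g n q)\<^sup>2 - frontal_K g n q)"
    by (intro smooth_germI[OF e1.r_pos] smooth_intros e1.smooth_curvatures[OF h_def m_def] open_ball)
  from smooth_germ_eventually_pos[OF this e1.principal_curvatures_distinct[OF h_def m_def M]]
  have disc: "\<forall>\<^sub>F q in nhds 0. (frontal_H g n q)\<^sup>2 - frontal_K g n q > 0" .
  have nonzero: "\<forall>\<^sub>F q in nhds 0. principal_curvature j g n q \<noteq> 0"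
    using assms(5,7) unfolding g_def n_def by blast
  have "\<forall>\<^sub>F r in at_right 0. adapted_cuspidal_edge g n h r T\<^sub>2 T\<^sub>3 V y z m \<and>
    (\<forall>q\<in>ball 0 r. (frontal_H g n q)\<^sup>2 - frontal_K g n q > 0) \<and>
    (\<forall>q\<in>ball 0 r. principal_curvature j g n q \<noteq> 0)"
    using edge small_balls[OF disc] small_balls[OF nonzero] by eventually_elim blast
  then obtain r2 where edge2: "adapted_cuspidal_edge g n h r2 T\<^sub>2 T\<^sub>3 V y z m"
    and disc2: "\<And>q. q \<in> ball 0 r2 \<Longrightarrow> (frontal_H g n q)\<^sup>2 - frontal_K g n q > 0"
    and nonzero2: "\<And>q. q \<in> ball 0 r2 \<Longrightarrow> principal_curvature j g n q \<noteq> 0"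
    using eventually_happens'[OF trivial_limit_at_right_real] by blast
  interpret e2: adapted_cuspidal_edge g n h r2 T\<^sub>2 T\<^sub>3 V y z m by (rule edge2)
  let ?k = "principal_curvature j g n 0"
  have formula: "gaussian_curvature (focal_surface j g n) 0 =
    - ((e1.M 0)\<^sup>2 * ?k ^ 4 / ((e1.M 0)\<^sup>2 + (e1.L 0 - ?k)\<^sup>2)\<^sup>2)"
    by (rule e2.focal_curvature_formula[OF h_def m_def disc2 nonzero2 M])
  moreover have "(e1.M 0)\<^sup>2 * ?k ^ 4 / ((e1.M 0)\<^sup>2 + (e1.L 0 - ?k)\<^sup>2)\<^sup>2 > 0"
    using M nonzero2[OF e2.zero_in] by (simp add: add_pos_nonneg zero_less_mult_iff)
  ultimately show ?thesis
    using torsion normal_curvature unfolding g_def n_def by simp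
qed

end
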